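(* Let $M \subset \mathbb{R}^2$ be a bounded open domain and let $f \in C^3_0(M)$ be a non-constant function. If $$\max_{M}|f| = \frac{1}{2\pi}\int_{M}\|H_f\|\,d\sigma,$$ then $M$ is an open disc, i.e. $M = D(p,R)$ for some $p\in\mathbb{R}^2$ and $R>0$.
   Context: A domain is a nonempty connected open set. For $k>0$, $C^k_0(M)$ is the space of all continuous functions $f:\overline{M}\to\mathbb{R}$ such that $f$ is $C^k$ on $M$ and $f$ vanishes on $\partial M$. $H_f$ denotes the Hessian (matrix) of $f$, $\|\cdot\|$ is the operator norm with respect to the Euclidean norm, and $d\sigma$ is Lebesgue (area) measure on $\mathbb{R}^2$. $D(p,R)$ is the open disc of radius $R$ centered at $p$. *)

theory Defs
  imports "HOL-Analysis.Analysis"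
begin

definition partial_deriv :: "'n::finite \<Rightarrow> (real^'n \<Rightarrow> real) \<Rightarrow> real^'n \<Rightarrow> real" where
  "partial_deriv i f x = frechet_derivative f (at x) (axis i 1)"

(* Meant for open S. Each level demands differentiability before partial derivatives are taken,
   so the junk values of frechet_derivative play no role. *)
primrec Ck_on :: "nat \<Rightarrow> (real^'n::finite) set \<Rightarrow> (real^'n \<Rightarrow> real) \<Rightarrow> bool" where
  "Ck_on 0 S f \<longleftrightarrow> continuous_on S f"
| "Ck_on (Suc k) S f \<longleftrightarrow>
     (\<forall>x\<in>S. f differentiable (at x)) \<and> (\<forall>i. Ck_on k S (partial_deriv i f))"

(* Functions are total in HOL; only the values of f on closure M are constrained. *)
definition Ck0 :: "nat \<Rightarrow> (real^'n::finite) set \<Rightarrow> (real^'n \<Rightarrow> real) set" where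
  "Ck0 k M = {f. continuous_on (closure M) f \<and> Ck_on k M f \<and> (\<forall>x\<in>frontier M. f x = 0)}"

definition hessian :: "(real^'n::finite \<Rightarrow> real) \<Rightarrow> real^'n \<Rightarrow> real^'n^'n" where
  "hessian f x = (\<chi> i j. partial_deriv i (partial_deriv j f) x)"

definition matrix_opnorm :: "real^'n::finite^'m::finite \<Rightarrow> real" where
  "matrix_opnorm A = onorm (\<lambda>v. A *v v)"

end

theory Submission
  imports Defs
begin

text \<open>Let \<open>\<bar>f\<bar>\<close> attain its maximum over the closure of \<open>M\<close> at \<open>p\<close>. Replacing \<open>f\<close> by
  \<open>- f\<close> if necessary, \<open>f p > 0\<close>. Let \<open>r\<close> be the distance from \<open>p\<close>, let
  \<open>e\<close> be the unit vector field perpendicular to the rays from \<open>p\<close>, and let \<open>\<theta>\<close> be the polar angle.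

  The key is a representation of point values by tangential second derivatives. If \<open>F\<close> is \<open>C\<^sup>2\<close> with
  compact support, then \<open>D\<^sup>2F(e, e) = F\<^sub>\<theta>\<^sub>\<theta> / r\<^sup>2 + F\<^sub>r / r\<close>. With respect to area
  \<open>r dr d\<theta>\<close>, the first term integrates to \<open>0\<close> over each circle and the second one to
  \<open>- 2 \<pi> F(p)\<close> in total, so \<open>2 \<pi> F(p) = - \<integral> D\<^sup>2F(e, e)\<close>. The identity is derived in
  \<open>smoothed_tangential_hessian_integral\<close> with \<open>1 / r\<^sup>2\<close> replaced by
  \<open>1 / (r\<^sup>2 + \<epsilon>)\<close>, because then it is the divergence theorem for a \<open>C\<^sup>1\<close> field with compact support.

  The function \<open>f\<close> need not have derivatives at the boundary of \<open>M\<close>. The identity is therefore applied to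
  \<open>\<phi> \<circ> f\<close>, where \<open>\<phi>\<close> is convex, vanishes on a neighbourhood of \<open>{..0}\<close> and has slope at most \<open>1\<close>.
  Convexity makes the extra term \<open>\<phi>''(f) (\<nabla>f \<bullet> e)\<^sup>2\<close> of \<open>D\<^sup>2(\<phi> \<circ> f)(e, e)\<close> nonnegative, so it can be
  dropped. When \<open>\<phi>\<close> tends to the positive part, the limit is
  \<open>2 \<pi> f(p) \<le> \<integral> - D\<^sup>2f(e, e)\<close>, integrated over \<open>{f > 0}\<close>, as
  \<open>max_value_le_tangential_hessian_integral\<close> says. The right-hand side is at most the
  integral of \<open>\<parallel>D\<^sup>2f\<parallel>\<close> over \<open>M\<close>.

  In the case of equality, \<open>D\<^sup>2f(e, e) = - \<parallel>D\<^sup>2f\<parallel>\<close> where \<open>f > 0\<close> and \<open>D\<^sup>2f = 0\<close> where \<open>f < 0\<close>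
  (\<open>equality_imp_tangential_eigenvalue\<close>). Hence \<open>e\<close> is an eigenvector of \<open>D\<^sup>2f\<close>, the component
  \<open>\<nabla>f \<bullet> e\<close> is constant along rays from \<open>p\<close>, and this constant is \<open>0\<close> because \<open>p\<close> is a critical point. So
  \<open>f\<close> is radial on the largest disc about \<open>p\<close> on which it is positive, and it vanishes on the whole bounding
  circle. That circle cannot meet \<open>M\<close>: at a common point \<open>y\<close>, either the radial derivative is negative,
  and then \<open>D\<^sup>2f(y) = 0\<close> by continuity from the region \<open>f < 0\<close> just outside, although
  \<open>D\<^sup>2f(e, e)\<close> at \<open>y\<close> is the radial derivative divided by the radius; or the radial derivative is zero, and
  then the inequality \<open>r \<bar>f\<^sub>r\<^sub>r\<bar> \<le> - f\<^sub>r\<close> forces \<open>f\<close> to be constant on a whole radius. Since \<open>M\<close> is connected, it is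
  the disc.\<close>

section \<open>Two integrals\<close>

text \<open>The integral of a compactly supported function is invariant under translation, so all its difference
  quotients have integral zero. They converge boundedly to the derivative.\<close>
lemma has_bochner_integral_directional_derivative_0:
  fixes G :: "'a::euclidean_space \<Rightarrow> real"
  assumes der: "\<And>x. (G has_derivative G' x) (at x)"
    and K: "compact K" "\<And>x. x \<notin> K \<Longrightarrow> G x = 0"
    and cont: "continuous_on UNIV (\<lambda>x. G' x e)"
  shows "has_bochner_integral lborel (\<lambda>x. G' x e) 0"
proof -
  have contG: "continuous_on UNIV G"
    using has_derivative_continuous[OF der] by (simp add: continuous_on_eq_continuous_at)
  have G'0: "G' x e = 0" if "x \<notin> K" for x
  proof -
    have "open (- K)" "x \<in> - K"
      using K that by (auto simp: compact_imp_closed)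
    then have "((\<lambda>x. 0) has_derivative G' x) (at x)"
      using has_derivative_transform_within_open[OF der[of x], of "- K" "\<lambda>x. 0"] K by auto
    then show ?thesis
      using has_derivative_unique[of "\<lambda>x. 0" "G' x" x "\<lambda>_. 0"] by (metis has_derivative_const)
  qed
  obtain C where C: "\<And>x. \<bar>G' x e\<bar> \<le> C"
  proof -
    have "compact ((\<lambda>x. G' x e) ` K)"
      using cont K by (intro compact_continuous_image) (auto intro: continuous_on_subset)
    then obtain C where C: "\<And>x. x \<in> K \<Longrightarrow> \<bar>G' x e\<bar> \<le> C"
      by (force dest!: compact_imp_bounded simp: bounded_iff)
    then have "\<bar>G' x e\<bar> \<le> max 0 C" for x
      using G'0[of x] C[of x] by (cases "x \<in> K") (auto simp: le_max_iff_disj)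
    then show ?thesis using that by blast
  qed
  \<comment> \<open>All the difference quotients with step at most 1 vanish outside this compact set.\<close>
  define K2 where "K2 = (\<lambda>(x, t). x - t *\<^sub>R e) ` (K \<times> {0..1::real})"
  have K2: "compact K2"
    unfolding K2_def using K
    by (intro compact_continuous_image compact_Times) (auto intro!: continuous_intros simp: case_prod_unfold)
  have inK2: "x \<in> K2" if "x + t *\<^sub>R e \<in> K" "0 \<le> t" "t \<le> 1" for x t
    unfolding K2_def using that by (intro image_eqI[of _ _ "(x + t *\<^sub>R e, t)"]) auto
  define h :: "nat \<Rightarrow> real" where "h n = 1 / (real n + 1)" for n
  have h: "0 < h n" "h n \<le> 1" for n by (auto simp: h_def)
  define D where "D n x = (G (x + h n *\<^sub>R e) - G x) / h n" for n x
  have line: "((\<lambda>s. G (x + s *\<^sub>R e)) has_real_derivative G' (x + s *\<^sub>R e) e) (at s)" for x s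
  proof -
    have "((\<lambda>s. G (x + s *\<^sub>R e)) has_derivative (\<lambda>t. G' (x + s *\<^sub>R e) (t *\<^sub>R e))) (at s)"
      by (rule has_derivative_compose[of "\<lambda>s. x + s *\<^sub>R e" _ _ _ G, OF _ der])
        (auto intro!: derivative_eq_intros)
    moreover have "(\<lambda>t. G' (x + s *\<^sub>R e) (t *\<^sub>R e)) = (*) (G' (x + s *\<^sub>R e) e)"
      using linear_scale[OF has_derivative_linear[OF der[of "x + s *\<^sub>R e"]]] by (auto simp: mult.commute)
    ultimately show ?thesis
      by (simp add: has_field_derivative_def)
  qed
  have Dbound: "norm (D n x) \<le> C * indicator K2 x" for n x
  proof (cases "x \<in> K2")
    case True
    have "\<exists>z>0. z < h n \<and> G (x + h n *\<^sub>R e) - G (x + 0 *\<^sub>R e) = (h n - 0) * G' (x + z *\<^sub>R e) e"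
      using h by (intro MVT2 line)
    then obtain z where "G (x + h n *\<^sub>R e) - G x = h n * G' (x + z *\<^sub>R e) e" by auto
    then have "D n x = G' (x + z *\<^sub>R e) e" using h[of n] by (simp add: D_def)
    then show ?thesis using C True by simp
  next
    case False
    then have "x + h n *\<^sub>R e \<notin> K" "x \<notin> K"
      using inK2[of x "h n"] inK2[of x 0] h[of n] by auto
    then show ?thesis using False K by (simp add: D_def)
  qed
  have intG: "integrable lborel G"
  proof -
    have "integrable lborel (\<lambda>x. indicator K x *\<^sub>R G x)"
      using K contG by (intro borel_integrable_compact) (auto intro: continuous_on_subset)
    moreover have "(\<lambda>x. indicator K x *\<^sub>R G x) = G"
      using K(2) by (auto simp: indicator_def fun_eq_iff)
    ultimately show ?thesis by simp
  qed
  have measG: "G \<in> borel_measurable borel"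
    using contG by (rule borel_measurable_continuous_onI)
  have shift: "has_bochner_integral lborel (\<lambda>x. G (x + c)) (integral\<^sup>L lborel G)" for c
  proof -
    have "has_bochner_integral (distr lborel borel ((+) c)) G (integral\<^sup>L lborel G)"
      unfolding lborel_distr_plus using intG by (simp add: has_bochner_integral_iff)
    then show ?thesis
      using measG by (simp add: has_bochner_integral_iff integrable_distr_eq integral_distr add.commute)
  qed
  have intD: "has_bochner_integral lborel (D n) 0" for n
  proof -
    have "has_bochner_integral lborel (\<lambda>x. G (x + h n *\<^sub>R e) - G (x + 0)) (integral\<^sup>L lborel G - integral\<^sup>L lborel G)"
      by (intro has_bochner_integral_diff shift)
    then have "has_bochner_integral lborel (\<lambda>x. (G (x + h n *\<^sub>R e) - G x) / h n) (0 / h n)"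
      by (intro has_bochner_integral_divide_zero) simp
    then show ?thesis by (simp add: D_def[abs_def])
  qed
  have h0: "h \<longlonglongrightarrow> 0"
    unfolding h_def[abs_def] using LIMSEQ_inverse_real_of_nat by (simp add: inverse_eq_divide add.commute)
  have Dlim: "(\<lambda>n. D n x) \<longlonglongrightarrow> G' x e" for x
  proof -
    have "((\<lambda>k. (G (x + k *\<^sub>R e) - G x) / k) \<longlongrightarrow> G' x e) (at 0)"
      using line[of x 0] by (simp add: DERIV_def)
    moreover have "filterlim h (at 0) sequentially"
      using h0 h by (intro filterlim_atI) (auto simp: less_imp_neq[THEN not_sym])
    ultimately show ?thesis
      unfolding D_def by (rule filterlim_compose)
  qed
  have dom: "integrable lborel (\<lambda>x. C * indicator K2 x)"
    using K2 by (intro integrable_mult_right integrable_real_indicator)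
      (use emeasure_bounded_finite[OF compact_imp_bounded[OF K2]] in \<open>auto simp: borel_compact\<close>)
  have meas: "(\<lambda>x. G' x e) \<in> borel_measurable lborel"
    using borel_measurable_continuous_onI[OF cont] by simp
  have measD: "D n \<in> borel_measurable lborel" for n
    using intD by (meson has_bochner_integral_iff borel_measurable_integrable)
  have "integrable lborel (\<lambda>x. G' x e)"
    by (rule integrable_dominated_convergence[where s = D, OF meas measD dom]) (use Dlim Dbound in auto)
  moreover have "(\<lambda>n. integral\<^sup>L lborel (D n)) \<longlonglongrightarrow> integral\<^sup>L lborel (\<lambda>x. G' x e)"
    by (rule integral_dominated_convergence[where s = D, OF meas measD dom]) (use Dlim Dbound in auto)
  moreover have "integral\<^sup>L lborel (D n) = 0" for n
    using intD by (simp add: has_bochner_integral_iff)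
  ultimately show ?thesis
    by (simp add: has_bochner_integral_iff LIMSEQ_const_iff)
qed

text \<open>The function is the integral of \<open>2 / (1 + s)\<^sup>3\<close> over \<open>s \<ge> (norm y)\<^sup>2\<close>. By Fubini's theorem,
  its integral over the plane reduces to one over \<open>s\<close>, in which the area \<open>\<pi> s\<close> of a disc is the weight.\<close>
lemma has_bochner_integral_inverse_square_plane:
  "has_bochner_integral lborel (\<lambda>y::real^2. 1 / (1 + (norm y)\<^sup>2)\<^sup>2) pi"
proof -
  have layer: "ennreal (1 / (1 + (norm y)\<^sup>2)\<^sup>2) =
      (\<integral>\<^sup>+s. ennreal (2 / (1 + s) ^ 3) * indicator {(norm y)\<^sup>2..} s * indicator {0..} s \<partial>lborel)"
    for y :: "real^2"
  proof -
    let ?f = "\<lambda>s::real. 2 / (1 + max 0 s) ^ 3"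
    have "(\<integral>\<^sup>+s. ennreal (?f s) * indicator {(norm y)\<^sup>2..} s \<partial>lborel)
        = ennreal (0 - (- 1 / (1 + (norm y)\<^sup>2)\<^sup>2))"
    proof (rule nn_integral_FTC_atLeast)
      show "DERIV (\<lambda>s. - 1 / (1 + s)\<^sup>2) s :> ?f s" if "(norm y)\<^sup>2 \<le> s" for s
      proof -
        have "0 \<le> s" using that by (meson order_trans zero_le_power2)
        then have "((\<lambda>s. - 1 / (1 + s)\<^sup>2) has_real_derivative 2 / (1 + s) ^ 3) (at s)"
          by (auto intro!: derivative_eq_intros) (auto simp: divide_simps power2_eq_square power3_eq_cube, simp add: algebra_simps eval_nat_numeral)
        with \<open>0 \<le> s\<close> show ?thesis by simp
      qed
      show "((\<lambda>s::real. - 1 / (1 + s)\<^sup>2) \<longlongrightarrow> 0) at_top" 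
        by (intro tendsto_divide_0[OF tendsto_const] filterlim_at_top_imp_at_infinity
            filterlim_pow_at_top filterlim_tendsto_add_at_top[OF tendsto_const] filterlim_ident) auto
    qed auto
    also have "(\<integral>\<^sup>+s. ennreal (?f s) * indicator {(norm y)\<^sup>2..} s \<partial>lborel) =
      (\<integral>\<^sup>+s. ennreal (2 / (1 + s) ^ 3) * indicator {(norm y)\<^sup>2..} s * indicator {0..} s \<partial>lborel)"
    proof (rule nn_integral_cong)
      fix s :: real
      show "ennreal (?f s) * indicator {(norm y)\<^sup>2..} s =
         ennreal (2 / (1 + s) ^ 3) * indicator {(norm y)\<^sup>2..} s * indicator {0..} s"
        using order_trans[of 0 "(norm y)\<^sup>2" s] by (auto simp: indicator_def max_def)
    qed
    finally show ?thesis by simp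
  qed
  have area: "(\<integral>\<^sup>+(y::real^2). indicator {(norm y)\<^sup>2..} s \<partial>lborel) = ennreal (pi * s)" if "0 \<le> s" for s
  proof -
    have "(\<integral>\<^sup>+(y::real^2). indicator {(norm y)\<^sup>2..} s \<partial>lborel)
        = (\<integral>\<^sup>+(y::real^2). indicator (cball 0 (sqrt s)) y \<partial>lborel)"
    proof (rule nn_integral_cong)
      fix y :: "real^2"
      show "(indicator {(norm y)\<^sup>2..} s :: ennreal) = indicator (cball 0 (sqrt s)) y"
        using that by (auto simp: indicator_def real_le_rsqrt real_sqrt_le_iff sqrt_le_D intro: sqrt_ge_absD)
    qed
    also have "\<dots> = ennreal (pi * s)"
      using that by (simp add: emeasure_cball unit_ball_vol_2)
    finally show ?thesis .
  qed
  have "(\<integral>\<^sup>+(y::real^2). ennreal (1 / (1 + (norm y)\<^sup>2)\<^sup>2) \<partial>lborel) =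
     (\<integral>\<^sup>+(y::real^2). \<integral>\<^sup>+s. ennreal (2 / (1 + s) ^ 3) * indicator {(norm y)\<^sup>2..} s * indicator {0..} s \<partial>lborel \<partial>lborel)"
    by (simp add: layer)
  also have "\<dots> = (\<integral>\<^sup>+s. \<integral>\<^sup>+(y::real^2). ennreal (2 / (1 + s) ^ 3) * indicator {(norm y)\<^sup>2..} s * indicator {0..} s \<partial>lborel \<partial>lborel)"
  proof (rule lborel_pair.Fubini'[symmetric])
    have "closed {z :: (real^2) \<times> real. (norm (fst z))\<^sup>2 \<le> snd z}"
      by (intro closed_Collect_le continuous_intros)
    then have [measurable]: "{z. (norm (fst z))\<^sup>2 \<le> snd z} \<in> sets (borel \<Otimes>\<^sub>M borel :: ((real^2) \<times> real) measure)"
      unfolding borel_prod by (rule borel_closed)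
    have "(\<lambda>z. ennreal (2 / (1 + snd z) ^ 3) * indicator {z. (norm (fst z))\<^sup>2 \<le> snd z} z * indicator {0..} (snd z))
       \<in> borel_measurable (borel \<Otimes>\<^sub>M borel :: ((real^2) \<times> real) measure)" by measurable
    moreover have "borel_measurable (borel \<Otimes>\<^sub>M borel :: ((real^2) \<times> real) measure) =
        borel_measurable (lborel \<Otimes>\<^sub>M lborel :: ((real^2) \<times> real) measure)"
      by (intro measurable_cong_sets sets_pair_measure_cong) auto
    ultimately show "case_prod (\<lambda>(y::real^2) s. ennreal (2 / (1 + s) ^ 3) * indicator {(norm y)\<^sup>2..} s * indicator {0..} s)
       \<in> borel_measurable (lborel \<Otimes>\<^sub>M lborel)"
      by (simp add: case_prod_unfold indicator_def)
  qed
  also have "\<dots> = (\<integral>\<^sup>+s. ennreal (2 / (1 + max 0 s) ^ 3 * (pi * max 0 s)) * indicator {0..} s \<partial>lborel)"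
  proof (rule nn_integral_cong)
    fix s :: real
    show "(\<integral>\<^sup>+(y::real^2). ennreal (2 / (1 + s) ^ 3) * indicator {(norm y)\<^sup>2..} s * indicator {0..} s \<partial>lborel)
       = ennreal (2 / (1 + max 0 s) ^ 3 * (pi * max 0 s)) * indicator {0..} s"
    proof (cases "0 \<le> s")
      case True
      have "(\<lambda>y::real^2. indicator {(norm y)\<^sup>2..} s :: ennreal) \<in> borel_measurable borel"
        unfolding indicator_def atLeast_iff by measurable
      then show ?thesis
        using True area[OF True] by (simp add: nn_integral_cmult flip: ennreal_mult')
    qed simp
  qed
  also have "\<dots> = ennreal (pi - pi * 0\<^sup>2 / (1 + 0)\<^sup>2)"
  proof (rule nn_integral_FTC_atLeast)
    show "DERIV (\<lambda>s. pi * s\<^sup>2 / (1 + s)\<^sup>2) s :> 2 / (1 + max 0 s) ^ 3 * (pi * max 0 s)" if "0 \<le> s" for s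
    proof -
      have "((\<lambda>s. pi * s\<^sup>2 / (1 + s)\<^sup>2) has_real_derivative 2 / (1 + s) ^ 3 * (pi * s)) (at s)"
        using that by (auto intro!: derivative_eq_intros)
          (auto simp: divide_simps power2_eq_square power3_eq_cube, simp add: algebra_simps eval_nat_numeral)
      with that show ?thesis by simp
    qed
    show "((\<lambda>s::real. pi * s\<^sup>2 / (1 + s)\<^sup>2) \<longlongrightarrow> pi) at_top" 
    proof -
      have "((\<lambda>s::real. pi * (1 - 1 / (1 + s))\<^sup>2) \<longlongrightarrow> pi * (1 - 0)\<^sup>2) at_top"
        by (intro tendsto_intros tendsto_divide_0[OF tendsto_const]
            filterlim_at_top_imp_at_infinity filterlim_tendsto_add_at_top[OF tendsto_const] filterlim_ident)
      moreover have "eventually (\<lambda>s::real. pi * (1 - 1 / (1 + s))\<^sup>2 = pi * s\<^sup>2 / (1 + s)\<^sup>2) at_top"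
        using eventually_gt_at_top[of 0]
        by eventually_elim (simp add: divide_simps power2_eq_square)
      ultimately show ?thesis
        by (simp add: tendsto_cong)
    qed
  qed auto
  finally have "(\<integral>\<^sup>+(y::real^2). ennreal (1 / (1 + (norm y)\<^sup>2)\<^sup>2) \<partial>lborel) = ennreal pi" by simp
  then show ?thesis
    by (intro has_bochner_integral_nn_integral) auto
qed

section \<open>Plane functions with continuous second derivatives\<close>

definition perp :: "real^2 \<Rightarrow> real^2" where
  "perp v = (\<chi> i. if i = 1 then - v $ 2 else v $ 1)"

lemma perp_component [simp]: "perp v $ 1 = - v $ 2" "perp v $ 2 = v $ 1"
  by (simp_all add: perp_def)

lemma inner_vec2: "v \<bullet> w = v $ 1 * w $ 1 + v $ 2 * w $ 2" for v w :: "real^2"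
  by (simp add: inner_vec_def sum_2)

lemma norm_perp [simp]: "norm (perp v) = norm v"
  by (simp add: norm_eq_sqrt_inner inner_vec2)

lemma perp_scaleR [simp]: "perp (c *\<^sub>R v) = c *\<^sub>R perp v"
  by (simp add: vec_eq_iff forall_2)

lemma perp_0 [simp]: "perp 0 = 0"
  by (simp add: vec_eq_iff forall_2)

lemma continuous_on_perp [continuous_intros]:
  "continuous_on S f \<Longrightarrow> continuous_on S (\<lambda>x. perp (f x))"
  unfolding perp_def
proof (rule continuous_on_vec_lambda)
  fix i :: 2
  assume f: "continuous_on S f"
  show "continuous_on S (\<lambda>x. if i = 1 then - f x $ 2 else f x $ 1)"
    using f by (cases "i = 1") (auto intro!: continuous_intros)
qed

text \<open>The gradient \<open>g\<close> and the Hessian \<open>H\<close> are carried along as explicit functions, so that truncating \<open>f\<close>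
  and extending it by zero act on the three functions together. The Hessian enters through its action on a fixed
  vector \<open>v\<close>, as the derivative of \<open>g \<bullet> v\<close>, because that is the form in which it is used along
  rays and circles.\<close>
definition C2_jet_on :: "(real^2) set \<Rightarrow> (real^2 \<Rightarrow> real) \<Rightarrow> (real^2 \<Rightarrow> real^2) \<Rightarrow> (real^2 \<Rightarrow> real^2^2) \<Rightarrow> bool"
  where "C2_jet_on M f g H \<longleftrightarrow> open M \<and>
     (\<forall>x\<in>M. (f has_derivative (\<lambda>h. g x \<bullet> h)) (at x)) \<and>
     (\<forall>x\<in>M. \<forall>v. ((\<lambda>y. g y \<bullet> v) has_derivative (\<lambda>h. h \<bullet> (H x *v v))) (at x)) \<and>
     continuous_on M H"

lemma C2_jet_onD:
  assumes "C2_jet_on M f g H"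
  shows "open M"
    and "x \<in> M \<Longrightarrow> (f has_derivative (\<lambda>h. g x \<bullet> h)) (at x)"
    and "x \<in> M \<Longrightarrow> ((\<lambda>y. g y \<bullet> v) has_derivative (\<lambda>h. h \<bullet> (H x *v v))) (at x)"
    and "continuous_on M H"
  using assms by (auto simp: C2_jet_on_def)

lemma C2_jet_on_continuous:
  assumes "C2_jet_on M f g H"
  shows "continuous_on M f" "continuous_on M g"
proof -
  show "continuous_on M f"
    using has_derivative_continuous[OF C2_jet_onD(2)[OF assms]] by (simp add: continuous_at_imp_continuous_on)
  have "continuous_on M (\<lambda>y. g y \<bullet> v)" for v
    using has_derivative_continuous[OF C2_jet_onD(3)[OF assms]] by (simp add: continuous_at_imp_continuous_on)
  then show "continuous_on M g"
    by (rule continuous_on_componentwise[THEN iffD2, rule_format])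
qed

lemma C2_jet_on_minus:
  assumes "C2_jet_on M f g H"
  shows "C2_jet_on M (\<lambda>x. - f x) (\<lambda>x. - g x) (\<lambda>x. - H x)"
proof -
  have "((\<lambda>y. - g y \<bullet> v) has_derivative (\<lambda>h. h \<bullet> (- H x *v v))) (at x)" if "x \<in> M" for x v
    using has_derivative_minus[OF C2_jet_onD(3)[OF assms that, of v]]
    by (simp add: inner_vec2 matrix_vector_mult_def sum_2 algebra_simps)
  moreover have "((\<lambda>x. - f x) has_derivative (\<lambda>h. - g x \<bullet> h)) (at x)" if "x \<in> M" for x
    using has_derivative_minus[OF C2_jet_onD(2)[OF assms that]] unfolding inner_minus_left .
  ultimately show ?thesis
    using C2_jet_onD(1)[OF assms] continuous_on_minus[OF C2_jet_onD(4)[OF assms]]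
    unfolding C2_jet_on_def by blast
qed

lemma outer_product_mult_vec: "(\<chi> i j. u $ i * u $ j) *v v = (u \<bullet> v) *\<^sub>R (u :: real^'n)"
  by (simp add: vec_eq_iff matrix_vector_mult_def inner_vec_def sum_distrib_left mult_ac)

lemma C2_jet_on_compose:
  assumes jet: "C2_jet_on M f g H"
    and d1: "\<And>t. (\<phi> has_real_derivative \<phi>' t) (at t)"
    and d2: "\<And>t. (\<phi>' has_real_derivative \<phi>'' t) (at t)"
    and cont: "continuous_on UNIV \<phi>''"
  shows "C2_jet_on M (\<lambda>x. \<phi> (f x)) (\<lambda>x. \<phi>' (f x) *\<^sub>R g x)
    (\<lambda>x. \<phi>' (f x) *\<^sub>R H x + \<phi>'' (f x) *\<^sub>R (\<chi> i j. g x $ i * g x $ j))"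
  unfolding C2_jet_on_def
proof (intro conjI ballI allI)
  show "open M" using C2_jet_onD(1)[OF jet] .
  fix x assume x: "x \<in> M"
  note df = C2_jet_onD(2)[OF jet x] and dg = C2_jet_onD(3)[OF jet x]
  show "((\<lambda>x. \<phi> (f x)) has_derivative (\<lambda>h. \<phi>' (f x) *\<^sub>R g x \<bullet> h)) (at x)"
    using has_derivative_compose[OF df d1[of "f x", unfolded has_field_derivative_def]] by simp
  have d\<phi>': "((\<lambda>x. \<phi>' (f x)) has_derivative (\<lambda>h. \<phi>'' (f x) * (g x \<bullet> h))) (at x)"
    using has_derivative_compose[OF df d2[of "f x", unfolded has_field_derivative_def]] by simp
  fix v
  have "((\<lambda>y. \<phi>' (f y) * (g y \<bullet> v)) has_derivative
     (\<lambda>h. \<phi>' (f x) * (h \<bullet> (H x *v v)) + \<phi>'' (f x) * (g x \<bullet> h) * (g x \<bullet> v))) (at x)"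
    using has_derivative_mult[OF d\<phi>' dg[of v]] .
  then show "((\<lambda>y. \<phi>' (f y) *\<^sub>R g y \<bullet> v) has_derivative
     (\<lambda>h. h \<bullet> ((\<phi>' (f x) *\<^sub>R H x + \<phi>'' (f x) *\<^sub>R (\<chi> i j. g x $ i * g x $ j)) *v v))) (at x)"
    by (simp add: matrix_vector_mult_add_rdistrib outer_product_mult_vec inner_add_right inner_commute
        mult_ac flip: scaleR_matrix_vector_assoc)
next
  have c': "continuous_on UNIV \<phi>'"
    using d2 by (auto intro!: continuous_at_imp_continuous_on DERIV_isCont)
  have "continuous_on M (\<lambda>x. \<phi>' (f x))" "continuous_on M (\<lambda>x. \<phi>'' (f x))"
    using C2_jet_on_continuous(1)[OF jet] continuous_on_compose2[OF c'] continuous_on_compose2[OF cont] by auto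
  then show "continuous_on M (\<lambda>x. \<phi>' (f x) *\<^sub>R H x + \<phi>'' (f x) *\<^sub>R (\<chi> i j. g x $ i * g x $ j))"
    using C2_jet_onD(4)[OF jet] C2_jet_on_continuous(2)[OF jet]
    by (intro continuous_intros continuous_on_vec_lambda)
qed

lemma C2_jet_on_zero_extension:
  assumes jet: "C2_jet_on M f g H" and K: "compact K" "K \<subseteq> M"
    and z: "\<And>x. x \<in> M - K \<Longrightarrow> f x = 0 \<and> g x = 0 \<and> H x = 0"
  shows "C2_jet_on UNIV (\<lambda>x. if x \<in> M then f x else 0) (\<lambda>x. if x \<in> M then g x else 0)
    (\<lambda>x. if x \<in> M then H x else 0)" (is "C2_jet_on UNIV ?f ?g ?H")
proof -
  note opM = C2_jet_onD(1)[OF jet]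
  have opK: "open (- K)" using K by (simp add: compact_imp_closed open_Compl)
  have outside: "?f y = 0" "?g y = 0" "?H y = 0" if "y \<notin> K" for y
    using z[of y] that by auto
  have "(?f has_derivative (\<lambda>h. ?g x \<bullet> h)) (at x)" for x
  proof (cases "x \<in> M")
    case True
    show ?thesis
      using has_derivative_transform_within_open[OF C2_jet_onD(2)[OF jet True] opM True, where g = ?f] True by simp
  next
    case False
    then have "x \<in> - K" using K by auto
    have "((\<lambda>_. 0) has_derivative (\<lambda>h::real^2. 0::real)) (at x)" by simp
    from has_derivative_transform_within_open[OF this opK \<open>x \<in> - K\<close>, where g = ?f] show ?thesis
      using outside False by simp
  qed
  moreover have "((\<lambda>y. ?g y \<bullet> v) has_derivative (\<lambda>h. h \<bullet> (?H x *v v))) (at x)" for x v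
  proof (cases "x \<in> M")
    case True
    show ?thesis
      using has_derivative_transform_within_open[OF C2_jet_onD(3)[OF jet True] opM True, where g = "\<lambda>y. ?g y \<bullet> v"] True by simp
  next
    case False
    then have "x \<in> - K" using K by auto
    have "((\<lambda>_. 0) has_derivative (\<lambda>h::real^2. 0::real)) (at x)" by simp
    from has_derivative_transform_within_open[OF this opK \<open>x \<in> - K\<close>, where g = "\<lambda>y. ?g y \<bullet> v"] show ?thesis
      using outside False by simp
  qed
  moreover have "continuous_on UNIV ?H"
  proof -
    have "continuous_on M ?H" using C2_jet_onD(4)[OF jet] by (simp cong: continuous_on_cong)
    moreover have "continuous_on (- K) ?H"
      by (rule continuous_on_eq[OF continuous_on_const[of "- K" 0]]) (use outside(3) in simp)
    moreover have "M \<union> - K = UNIV" using K by auto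
    ultimately show ?thesis
      using continuous_on_open_Un[OF opM opK, of ?H] by simp
  qed
  ultimately show ?thesis by (auto simp: C2_jet_on_def)
qed

section \<open>Point values as integrals of tangential second derivatives\<close>

text \<open>Let \<open>y = x - p\<close> and \<open>w = 1 / (\<bar>y\<bar>\<^sup>2 + \<epsilon>)\<close>. The two integrands add up to the divergence of the field
  \<open>w F y + w (\<nabla>F \<bullet> perp y) perp y\<close>. Its first term produces the kernel on the left together with \<open>w \<nabla>F \<bullet> y\<close>;
  the rotation field \<open>perp y\<close> annihilates \<open>w\<close>, so its second term produces the quadratic form of the
  Hessian together with \<open>- w \<nabla>F \<bullet> y\<close>, and the gradient terms cancel.\<close>
lemma smoothed_tangential_hessian_integral:
  assumes jet: "C2_jet_on UNIV F G H" and K: "compact K" "\<And>x. x \<notin> K \<Longrightarrow> F x = 0"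
    and eps: "\<epsilon> > 0"
  shows "integrable lborel (\<lambda>x. perp (x - p) \<bullet> (H x *v perp (x - p)) / ((norm (x - p))\<^sup>2 + \<epsilon>))"
    "(\<integral>x. 2 * \<epsilon> / ((norm (x - p))\<^sup>2 + \<epsilon>)\<^sup>2 * F x \<partial>lborel) =
     - (\<integral>x. perp (x - p) \<bullet> (H x *v perp (x - p)) / ((norm (x - p))\<^sup>2 + \<epsilon>) \<partial>lborel)"
proof -
  define a where "a x = x $ 1 - p $ 1" for x :: "real^2"
  define b where "b x = x $ 2 - p $ 2" for x :: "real^2"
  define w where "w x = inverse ((a x)\<^sup>2 + (b x)\<^sup>2 + \<epsilon>)" for x
  define q where "q x = a x * G x $ 2 - b x * G x $ 1" for x
  \<comment> \<open>The components of the field; \<open>q\<close> is the derivative of \<open>F\<close> along the rotation field.\<close>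
  define V1 where "V1 x = w x * (F x * a x - q x * b x)" for x
  define V2 where "V2 x = w x * (F x * b x + q x * a x)" for x
  define w' where "w' x h = - ((2 * a x * h $ 1 + 2 * b x * h $ 2) * (w x)\<^sup>2)" for x and h :: "real^2"
  define q' where "q' x h = (a x * (h $ 1 * H x $ 1 $ 2 + h $ 2 * H x $ 2 $ 2) + h $ 1 * G x $ 2)
     - (b x * (h $ 1 * H x $ 1 $ 1 + h $ 2 * H x $ 2 $ 1) + h $ 2 * G x $ 1)" for x and h :: "real^2"
  define V1' where "V1' x h = w x * ((F x * h $ 1 + (G x \<bullet> h) * a x) - (q x * h $ 2 + q' x h * b x))
     + w' x h * (F x * a x - q x * b x)" for x h
  define V2' where "V2' x h = w x * ((F x * h $ 2 + (G x \<bullet> h) * b x) + (q x * h $ 1 + q' x h * a x))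
     + w' x h * (F x * b x + q x * a x)" for x h
  have pos: "(a x)\<^sup>2 + (b x)\<^sup>2 + \<epsilon> > 0" for x using eps by (simp add: add_nonneg_pos)
  have da: "(a has_derivative (\<lambda>h. h $ 1)) (at x)" and db: "(b has_derivative (\<lambda>h. h $ 2)) (at x)" for x
    unfolding a_def[abs_def] b_def[abs_def] by (auto intro!: derivative_eq_intros bounded_linear_imp_has_derivative)
  have dw: "(w has_derivative w' x) (at x)" for x
  proof -
    have "((\<lambda>x. (a x)\<^sup>2 + (b x)\<^sup>2 + \<epsilon>) has_derivative (\<lambda>h. 2 * a x * h $ 1 + 2 * b x * h $ 2)) (at x)"
      using da[of x] db[of x] by (auto intro!: derivative_eq_intros)
    from Deriv.has_derivative_inverse[OF _ this] show ?thesis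
      using pos[of x] unfolding w_def[abs_def] w'_def[abs_def]
      by (simp add: power2_eq_square mult_ac)
  qed
  have dG1: "((\<lambda>x. G x $ 1) has_derivative (\<lambda>h. h $ 1 * H x $ 1 $ 1 + h $ 2 * H x $ 2 $ 1)) (at x)" for x
    using C2_jet_onD(3)[OF jet, of x "axis 1 1"]
    by (simp add: inner_axis inner_vec2 matrix_vector_mult_def sum_2 axis_def)
  have dG2: "((\<lambda>x. G x $ 2) has_derivative (\<lambda>h. h $ 1 * H x $ 1 $ 2 + h $ 2 * H x $ 2 $ 2)) (at x)" for x
    using C2_jet_onD(3)[OF jet, of x "axis 2 1"]
    by (simp add: inner_axis inner_vec2 matrix_vector_mult_def sum_2 axis_def)
  have dF: "(F has_derivative (\<lambda>h. G x \<bullet> h)) (at x)" for x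
    using C2_jet_onD(2)[OF jet] by simp
  have dq: "(q has_derivative q' x) (at x)" for x
    unfolding q_def[abs_def] q'_def[abs_def]
    by (intro has_derivative_diff has_derivative_mult da db dG1 dG2)
  have dV1: "(V1 has_derivative V1' x) (at x)" for x
    unfolding V1_def[abs_def] V1'_def[abs_def]
    by (intro has_derivative_diff has_derivative_mult da db dF dq dw)
  have dV2: "(V2 has_derivative V2' x) (at x)" for x
    unfolding V2_def[abs_def] V2'_def[abs_def]
    by (intro has_derivative_add has_derivative_mult da db dF dq dw)
  have G0: "G x = 0" if "x \<notin> K" for x
  proof -
    have "open (- K)" "x \<in> - K" using K that by (auto simp: compact_imp_closed)
    then have "((\<lambda>x. 0) has_derivative (\<lambda>h. G x \<bullet> h)) (at x)"
      using has_derivative_transform_within_open[OF dF[of x], of "- K" "\<lambda>x. 0"] K by auto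
    then have "(\<lambda>h. G x \<bullet> h) = (\<lambda>h. 0)"
      using has_derivative_unique has_derivative_const by blast
    then show ?thesis by (metis inner_eq_zero_iff)
  qed
  have V0: "V1 x = 0" "V2 x = 0" if "x \<notin> K" for x
    using G0[OF that] K(2)[OF that] by (simp_all add: V1_def V2_def q_def)
  have cont [continuous_intros]: "continuous_on UNIV F" "continuous_on UNIV G" "continuous_on UNIV H"
    using C2_jet_on_continuous[OF jet] C2_jet_onD(4)[OF jet] by auto
  have cont' [continuous_intros]: "continuous_on UNIV a" "continuous_on UNIV b" "continuous_on UNIV w" "continuous_on UNIV q"
    using has_derivative_continuous[OF da] has_derivative_continuous[OF db]
       has_derivative_continuous[OF dw] has_derivative_continuous[OF dq]
    by (auto simp: continuous_on_eq_continuous_at)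
  let ?e1 = "axis 1 1 :: real^2" and ?e2 = "axis 2 1 :: real^2"
  have "has_bochner_integral lborel (\<lambda>x. V1' x ?e1) 0"
    by (rule has_bochner_integral_directional_derivative_0[OF dV1 K(1) V0(1)])
      (auto simp: V1'_def q'_def w'_def intro!: continuous_intros)
  moreover have "has_bochner_integral lborel (\<lambda>x. V2' x ?e2) 0"
    by (rule has_bochner_integral_directional_derivative_0[OF dV2 K(1) V0(2)])
      (auto simp: V2'_def q'_def w'_def intro!: continuous_intros)
  ultimately have div: "has_bochner_integral lborel (\<lambda>x. V1' x ?e1 + V2' x ?e2) (0 + 0)"
    by (rule has_bochner_integral_add)
  define Q where "Q x = perp (x - p) \<bullet> (H x *v perp (x - p))" for x
  have nrm: "(norm (x - p))\<^sup>2 + \<epsilon> = (a x)\<^sup>2 + (b x)\<^sup>2 + \<epsilon>" for x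
    unfolding power2_norm_eq_inner inner_vec2 by (simp add: a_def b_def power2_eq_square)
  have divergence: "V1' x ?e1 + V2' x ?e2 = 2 * \<epsilon> * (w x)\<^sup>2 * F x + w x * Q x" for x
  proof -
    have w1: "w x * ((a x)\<^sup>2 + (b x)\<^sup>2 + \<epsilon>) = 1"
      using pos[of x] by (simp add: w_def)
    have Q: "Q x = (b x)\<^sup>2 * H x $ 1 $ 1 - a x * b x * (H x $ 1 $ 2 + H x $ 2 $ 1) + (a x)\<^sup>2 * H x $ 2 $ 2"
      unfolding Q_def a_def b_def
      by (simp add: inner_vec2 matrix_vector_mult_def sum_2 power2_eq_square) (simp add: algebra_simps)
    have e: "?e1 $ 1 = 1" "?e1 $ 2 = 0" "?e2 $ 1 = 0" "?e2 $ 2 = 1" by (simp_all add: axis_def)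
    have "V1' x ?e1 + V2' x ?e2 = 2 * w x * F x + w x * Q x - 2 * (w x)\<^sup>2 * ((a x)\<^sup>2 + (b x)\<^sup>2) * F x"
      unfolding V1'_def V2'_def w'_def q'_def Q inner_vec2 e q_def
      by (simp add: power2_eq_square algebra_simps)
    also have "2 * w x * F x = 2 * w x * (w x * ((a x)\<^sup>2 + (b x)\<^sup>2 + \<epsilon>)) * F x" using w1 by simp
    finally show ?thesis by (simp add: power2_eq_square algebra_simps)
  qed
  have intF: "integrable lborel (\<lambda>x. 2 * \<epsilon> * (w x)\<^sup>2 * F x)"
  proof -
    have "continuous_on UNIV (\<lambda>x. 2 * \<epsilon> * (w x)\<^sup>2 * F x)" by (intro continuous_intros)
    then have "integrable lborel (\<lambda>x. indicator K x *\<^sub>R (2 * \<epsilon> * (w x)\<^sup>2 * F x))"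
      using K by (intro borel_integrable_compact) (auto intro: continuous_on_subset)
    moreover have "(\<lambda>x. indicator K x *\<^sub>R (2 * \<epsilon> * (w x)\<^sup>2 * F x)) = (\<lambda>x. 2 * \<epsilon> * (w x)\<^sup>2 * F x)"
      using K(2) by (auto simp: indicator_def fun_eq_iff)
    ultimately show ?thesis by simp
  qed
  have "has_bochner_integral lborel (\<lambda>x. (V1' x ?e1 + V2' x ?e2) - 2 * \<epsilon> * (w x)\<^sup>2 * F x)
     (0 + 0 - integral\<^sup>L lborel (\<lambda>x. 2 * \<epsilon> * (w x)\<^sup>2 * F x))"
    using div intF by (intro has_bochner_integral_diff) (auto simp: has_bochner_integral_iff)
  then have "has_bochner_integral lborel (\<lambda>x. Q x / ((norm (x - p))\<^sup>2 + \<epsilon>))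
     (- integral\<^sup>L lborel (\<lambda>x. 2 * \<epsilon> / ((norm (x - p))\<^sup>2 + \<epsilon>)\<^sup>2 * F x))"
    unfolding divergence nrm by (simp add: w_def divide_inverse power_inverse mult_ac)
  then show "integrable lborel (\<lambda>x. perp (x - p) \<bullet> (H x *v perp (x - p)) / ((norm (x - p))\<^sup>2 + \<epsilon>))"
    "(\<integral>x. 2 * \<epsilon> / ((norm (x - p))\<^sup>2 + \<epsilon>)\<^sup>2 * F x \<partial>lborel) =
     - (\<integral>x. perp (x - p) \<bullet> (H x *v perp (x - p)) / ((norm (x - p))\<^sup>2 + \<epsilon>) \<partial>lborel)"
    by (auto simp: has_bochner_integral_iff Q_def)
qed

section \<open>The sharp bound on the maximum\<close>

lemma has_real_derivative_glue_0:
  fixes h h' :: "real \<Rightarrow> real"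
  assumes h: "\<And>t. 0 \<le> t \<Longrightarrow> (h has_real_derivative h' t) (at t)" and "h 0 = 0" "h' 0 = 0"
  shows "((\<lambda>t. if t \<le> 0 then 0 else h t) has_real_derivative (if t \<le> 0 then 0 else h' t)) (at t)"
    (is "(?f has_real_derivative _) _")
proof -
  consider "t < 0" | "t = 0" | "t > 0" by linarith
  then show ?thesis
  proof cases
    case 1
    have "((\<lambda>_. 0) has_real_derivative 0) (at t)" by simp
    from has_field_derivative_transform_within_open[OF this, of "{..<0}" ?f] 1 show ?thesis by simp
  next
    case 3
    have "(h has_real_derivative h' t) (at t)" using h 3 by simp
    from has_field_derivative_transform_within_open[OF this, of "{0<..}" ?f] 3 show ?thesis by simp
  next
    case 2
    have "((\<lambda>x. h x / x) \<longlongrightarrow> 0) (at 0)"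
      using h[of 0] assms(2,3) by (simp add: DERIV_def)
    then have lim: "((\<lambda>x. \<bar>h x / x\<bar>) \<longlongrightarrow> 0) (at 0)"
      by (rule tendsto_rabs_zero)
    have le: "norm (?f x / x) \<le> \<bar>h x / x\<bar>" for x
      by (cases "x \<le> 0") (simp_all del: abs_divide)
    have "((\<lambda>x. ?f x / x) \<longlongrightarrow> 0) (at 0)"
      by (rule Lim_null_comparison[OF always_eventually lim]) (use le in blast)
    then show ?thesis using 2 by (simp add: DERIV_def cong: if_cong)
  qed
qed

text \<open>A \<open>C\<^sup>2\<close> convex substitute for the positive part: its slope \<open>u\<^sup>2 / (1 + u\<^sup>2)\<close> increases from \<open>0\<close>
  to \<open>1\<close>, and it stays within bounded distance of the positive part, so \<open>soft_pos (N t) / N\<close> tends to the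
  positive part of \<open>t\<close>. The two functions after it are its first and second derivatives.\<close>
definition soft_pos :: "real \<Rightarrow> real" where
  "soft_pos u = (if u \<le> 0 then 0 else u - arctan u)"
definition soft_pos' :: "real \<Rightarrow> real" where
  "soft_pos' u = (if u \<le> 0 then 0 else u\<^sup>2 / (1 + u\<^sup>2))"
definition soft_pos'' :: "real \<Rightarrow> real" where
  "soft_pos'' u = (if u \<le> 0 then 0 else 2 * u / (1 + u\<^sup>2)\<^sup>2)"

lemma one_plus_square_pos: "1 + u\<^sup>2 > (0::real)"
  by (simp add: add_pos_nonneg)

lemma DERIV_soft_pos: "(soft_pos has_real_derivative soft_pos' u) (at u)"
  unfolding soft_pos_def[abs_def] soft_pos'_def
proof (rule has_real_derivative_glue_0)
  fix t :: real
  show "((\<lambda>u. u - arctan u) has_real_derivative t\<^sup>2 / (1 + t\<^sup>2)) (at t)"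
    using one_plus_square_pos[of t]
    by (auto intro!: derivative_eq_intros simp: field_simps)
qed auto

lemma DERIV_soft_pos': "(soft_pos' has_real_derivative soft_pos'' u) (at u)"
  unfolding soft_pos'_def[abs_def] soft_pos''_def
proof (rule has_real_derivative_glue_0)
  fix t :: real
  have "1 + t\<^sup>2 \<noteq> 0" using one_plus_square_pos[of t] by simp
  then show "((\<lambda>u. u\<^sup>2 / (1 + u\<^sup>2)) has_real_derivative 2 * t / (1 + t\<^sup>2)\<^sup>2) (at t)"
    by (auto intro!: derivative_eq_intros simp: divide_simps)
      (simp_all add: algebra_simps power2_eq_square)
qed auto

lemma continuous_soft_pos'': "continuous_on UNIV soft_pos''"
proof -
  have eq: "soft_pos'' = (\<lambda>u. 2 * max 0 u / (1 + (max 0 u)\<^sup>2)\<^sup>2)"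
    by (auto simp: soft_pos''_def fun_eq_iff max_def)
  have "(1 + (max 0 u)\<^sup>2)\<^sup>2 \<noteq> 0" for u :: real
    using one_plus_square_pos[of "max 0 u"] by simp
  then have "continuous_on UNIV (\<lambda>u::real. 2 * max 0 u / (1 + (max 0 u)\<^sup>2)\<^sup>2)"
    by (auto intro!: continuous_intros)
  then show ?thesis unfolding eq .
qed

lemma soft_pos_bounds:
  "0 \<le> soft_pos' u" "soft_pos' u \<le> 1" "0 \<le> soft_pos'' u" "soft_pos u \<le> max 0 u" "u - 2 \<le> soft_pos u" "0 \<le> soft_pos u"
proof -
  show "0 \<le> soft_pos' u" "soft_pos' u \<le> 1" "0 \<le> soft_pos'' u"
    using one_plus_square_pos[of u] by (auto simp: soft_pos'_def soft_pos''_def divide_simps)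
  show "soft_pos u \<le> max 0 u" by (simp add: soft_pos_def)
  show "u - 2 \<le> soft_pos u"
    using arctan_ubound[of u] pi_less_4 by (auto simp: soft_pos_def)
  show "0 \<le> soft_pos u"
    using arctan_le_self[of u] by (auto simp: soft_pos_def)
qed

lemma soft_pos'_limit:
  "(\<lambda>n. soft_pos' (real (Suc n) * t - 1)) \<longlonglongrightarrow> (if 0 < t then 1 else 0)"
proof (cases "0 < t")
  case False
  then have "real (Suc n) * t - 1 \<le> 0" for n
    using mult_nonneg_nonpos[of "real (Suc n)" t] by (simp del: of_nat_Suc)
  then show ?thesis using False by (simp add: soft_pos'_def)
next
  case True
  have "filterlim (\<lambda>n. real (Suc n)) at_top sequentially"
    by (simp only: filterlim_sequentially_Suc filterlim_real_sequentially)
  then have top: "filterlim (\<lambda>n. real (Suc n) * t - 1) at_top sequentially"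
    using True filterlim_tendsto_add_at_top[OF tendsto_const[of "-1"] 
        filterlim_at_top_mult_tendsto_pos[OF tendsto_const[of t]], of "\<lambda>n. real (Suc n)"]
    by (simp add: algebra_simps del: of_nat_Suc)
  have "((\<lambda>u::real. 1 - 1 / (1 + u\<^sup>2)) \<longlongrightarrow> 1 - 0) at_top"
    by (intro tendsto_intros tendsto_divide_0[OF tendsto_const] filterlim_at_top_imp_at_infinity
        filterlim_tendsto_add_at_top[OF tendsto_const] filterlim_pow_at_top filterlim_ident) auto
  moreover have "eventually (\<lambda>u::real. 1 - 1 / (1 + u\<^sup>2) = soft_pos' u) at_top"
    using eventually_gt_at_top[of 0]
    by eventually_elim (use one_plus_square_pos in \<open>simp add: soft_pos'_def field_simps less_imp_neq[THEN not_sym]\<close>)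
  ultimately have "(soft_pos' \<longlongrightarrow> 1) at_top"
    by (simp add: tendsto_cong)
  from filterlim_compose[OF this top] show ?thesis using True by simp
qed

lemma integral_plane_rescale:
  fixes h :: "real^2 \<Rightarrow> real"
  assumes [measurable]: "h \<in> borel_measurable borel" and "c \<noteq> 0"
  shows "(\<integral>x. h x \<partial>lborel) = (\<integral>y. c\<^sup>2 * h (p + c *\<^sub>R y) \<partial>lborel)"
proof -
  have "(\<integral>x. h x \<partial>lborel) = integral\<^sup>L (density (distr lborel borel (\<lambda>y. p + c *\<^sub>R y)) (\<lambda>_. ennreal (\<bar>c\<bar> ^ DIM(real^2)))) h"
    using lborel_affine[OF \<open>c \<noteq> 0\<close>, of p] by (simp add: ennreal_power)
  also have "\<dots> = (\<integral>y. c\<^sup>2 * h (p + c *\<^sub>R y) \<partial>lborel)"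
    by (subst integral_density) (auto simp: integral_distr)
  finally show ?thesis .
qed

text \<open>The smoothed identity is applied to \<open>\<phi> n \<circ> f\<close>, extended by zero, with \<open>\<phi> n t = soft_pos (N t - 1) / N\<close>
  and \<open>N = n + 1\<close>. The shift by \<open>1\<close> confines the support to the compact set where \<open>f \<ge> 1 / N\<close>. With
  \<open>\<epsilon> = 1 / N\<^sup>2\<close> one limit in \<open>n\<close> removes both the truncation and the smoothing. At \<open>x = p\<close> the
  quotient in \<open>d\<close> is \<open>0 / 0 = 0\<close>, which is also the value of its approximations.\<close>
lemma max_value_le_tangential_hessian_integral:
  assumes jet: "C2_jet_on M f g H" and bdd: "bounded M"
    and contf: "continuous_on (closure M) f" and bd: "\<And>x. x \<in> frontier M \<Longrightarrow> f x = 0"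
    and p: "p \<in> M" "f p > 0" and max: "\<And>x. x \<in> M \<Longrightarrow> f x \<le> f p"
    and A: "\<And>x v. x \<in> M \<Longrightarrow> \<bar>v \<bullet> (H x *v v)\<bar> \<le> A x * (norm v)\<^sup>2"
    and intA: "integrable lborel (\<lambda>x. indicator M x * A x)"
  defines "d \<equiv> (\<lambda>x. indicator {x \<in> M. f x > 0} x *
      (- (perp (x - p) \<bullet> (H x *v perp (x - p))) / (norm (x - p))\<^sup>2))"
  shows "integrable lborel d" "2 * pi * f p \<le> (\<integral>x. d x \<partial>lborel)"
proof -
  note opM = C2_jet_onD(1)[OF jet]
  define Q where "Q x = perp (x - p) \<bullet> (H x *v perp (x - p))" for x
  define N where "N n = real (Suc n)" for n
  have N: "N n > 0" for n by (simp add: N_def)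
  define \<epsilon> where "\<epsilon> n = (1 / N n)\<^sup>2" for n
  have eps: "\<epsilon> n > 0" for n using N[of n] by (simp add: \<epsilon>_def)
  define \<phi> where "\<phi> n t = soft_pos (N n * t - 1) / N n" for n t
  define \<phi>' where "\<phi>' n t = soft_pos' (N n * t - 1)" for n t
  define \<phi>'' where "\<phi>'' n t = N n * soft_pos'' (N n * t - 1)" for n t
  have inner: "((\<lambda>t. N n * t - 1) has_real_derivative N n) (at t)" for n t
    by (auto intro!: derivative_eq_intros)
  have d\<phi>: "(\<phi> n has_real_derivative \<phi>' n t) (at t)" for n t
    using DERIV_cdivide[OF DERIV_chain2[OF DERIV_soft_pos inner], of n "N n" t] N[of n]
    by (simp add: \<phi>_def[abs_def] \<phi>'_def)
  have d\<phi>': "(\<phi>' n has_real_derivative \<phi>'' n t) (at t)" for n t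
    using DERIV_chain2[OF DERIV_soft_pos' inner, of n t]
    by (simp add: \<phi>'_def[abs_def] \<phi>''_def mult.commute)
  have c\<phi>'': "continuous_on UNIV (\<phi>'' n)" for n
    unfolding \<phi>''_def[abs_def]
    by (intro continuous_intros continuous_on_compose2[OF continuous_soft_pos'']) auto
  define Fn where "Fn n x = (if x \<in> M then \<phi> n (f x) else 0)" for n x
  define Gn where "Gn n x = (if x \<in> M then \<phi>' n (f x) *\<^sub>R g x else 0)" for n x
  define Hn where "Hn n x = (if x \<in> M then \<phi>' n (f x) *\<^sub>R H x + \<phi>'' n (f x) *\<^sub>R (\<chi> i j. g x $ i * g x $ j) else 0)" for n x
  define K where "K n = {x \<in> closure M. 1 / N n \<le> f x}" for n
  have K: "compact (K n)" "K n \<subseteq> M" for n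
  proof -
    have "closed (K n)"
      unfolding K_def using continuous_closed_preimage[OF contf closed_closure, of "{1 / N n ..}"]
      by (simp add: vimage_def Int_def)
    moreover have "bounded (K n)"
      by (rule bounded_subset[OF bounded_closure[OF bdd]]) (auto simp: K_def)
    ultimately show "compact (K n)" by (simp add: compact_eq_bounded_closed)
    show "K n \<subseteq> M"
    proof
      fix x assume x: "x \<in> K n"
      then have "f x > 0" unfolding K_def using N[of n] by (auto intro: less_le_trans[of 0 "1 / N n"])
      then have "x \<notin> frontier M" using bd by force
      then show "x \<in> M" using x opM by (auto simp: K_def frontier_def interior_open)
    qed
  qed
  have van: "\<phi> n t = 0" "\<phi>' n t = 0" "\<phi>'' n t = 0" if "t < 1 / N n" for n t
  proof -
    have "N n * t - 1 \<le> 0" using that N[of n] by (simp add: field_simps)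
    then show "\<phi> n t = 0" "\<phi>' n t = 0" "\<phi>'' n t = 0"
      by (simp_all add: \<phi>_def \<phi>'_def \<phi>''_def soft_pos_def soft_pos'_def soft_pos''_def)
  qed
  have offK: "f x < 1 / N n" if "x \<in> M" "x \<notin> K n" for x n
    using that closure_subset[of M] by (auto simp: K_def)
  have jetn: "C2_jet_on UNIV (Fn n) (Gn n) (Hn n)" for n
    unfolding Fn_def[abs_def] Gn_def[abs_def] Hn_def[abs_def]
    by (rule C2_jet_on_zero_extension[OF C2_jet_on_compose[OF jet d\<phi> d\<phi>' c\<phi>''] K[of n]])
      (use van offK in auto)
  have FnK: "Fn n x = 0" if "x \<notin> K n" for n x
    using van offK that by (auto simp: Fn_def)
  note main = smoothed_tangential_hessian_integral[OF jetn K(1) FnK eps, where p = p]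

  \<comment> \<open>The kernel has mass \<open>2 \<pi>\<close> and concentrates at \<open>p\<close>; rescaling by \<open>1 / N\<close> turns it into a fixed one.\<close>
  define L where "L n = (\<integral>x. 2 * \<epsilon> n / ((norm (x - p))\<^sup>2 + \<epsilon> n)\<^sup>2 * Fn n x \<partial>lborel)" for n
  have contFn: "continuous_on UNIV (Fn n)" for n
    using C2_jet_on_continuous(1)[OF jetn] .
  have measFn [measurable]: "Fn n \<in> borel_measurable borel" for n
    using borel_measurable_continuous_onI[OF contFn] .
  define l where "l n y = 2 * (1 / (1 + (norm y)\<^sup>2)\<^sup>2) * Fn n (p + (1 / N n) *\<^sub>R y)" for n and y :: "real^2"
  have L: "L n = (\<integral>y. l n y \<partial>lborel)" for n
  proof -
    have "L n = (\<integral>y. (1 / N n)\<^sup>2 * (2 * \<epsilon> n / ((norm ((p + (1 / N n) *\<^sub>R y) - p))\<^sup>2 + \<epsilon> n)\<^sup>2 * Fn n (p + (1 / N n) *\<^sub>R y)) \<partial>lborel)"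
      unfolding L_def using N[of n] by (intro integral_plane_rescale) auto
    also have "\<dots> = (\<integral>y. l n y \<partial>lborel)"
    proof (rule Bochner_Integration.integral_cong[OF refl])
      fix y :: "real^2"
      have "(1 / N n)\<^sup>2 * (2 * \<epsilon> n / ((norm ((p + (1 / N n) *\<^sub>R y) - p))\<^sup>2 + \<epsilon> n)\<^sup>2) = 2 * (\<epsilon> n)\<^sup>2 / (\<epsilon> n * (1 + (norm y)\<^sup>2))\<^sup>2"
        using N[of n] by (simp add: \<epsilon>_def power_mult_distrib algebra_simps power2_eq_square)
      also have "\<dots> = 2 * (1 / (1 + (norm y)\<^sup>2)\<^sup>2)"
        using eps[of n] by (simp add: power_mult_distrib)
      finally have e: "(1 / N n)\<^sup>2 * (2 * \<epsilon> n / ((norm ((p + (1 / N n) *\<^sub>R y) - p))\<^sup>2 + \<epsilon> n)\<^sup>2) = 2 * (1 / (1 + (norm y)\<^sup>2)\<^sup>2)" .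
      show "(1 / N n)\<^sup>2 * (2 * \<epsilon> n / ((norm ((p + (1 / N n) *\<^sub>R y) - p))\<^sup>2 + \<epsilon> n)\<^sup>2 * Fn n (p + (1 / N n) *\<^sub>R y)) = l n y"
        unfolding l_def e[symmetric] by (rule mult.assoc[symmetric])
    qed
    finally show ?thesis .
  qed
  have \<phi>_bounds: "0 \<le> \<phi> n t" "\<phi> n t \<le> max 0 t" "t - 3 / N n \<le> \<phi> n t" for n t
  proof -
    show "0 \<le> \<phi> n t" using soft_pos_bounds(6) N[of n] by (simp add: \<phi>_def)
    have "\<phi> n t \<le> max 0 (N n * t - 1) / N n"
      unfolding \<phi>_def using soft_pos_bounds(4) N[of n] by (simp add: divide_right_mono)
    also have "\<dots> \<le> max 0 t"
    proof (cases "N n * t - 1 \<le> 0")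
      case False
      have "(N n * t - 1) / N n \<le> t" using N[of n] by (simp add: field_simps)
      with False show ?thesis by (simp add: max_def)
    qed simp
    finally show "\<phi> n t \<le> max 0 t" .
    have "(N n * t - 1 - 2) / N n \<le> \<phi> n t"
      unfolding \<phi>_def using soft_pos_bounds(5)[of "N n * t - 1"] N[of n] by (intro divide_right_mono) auto
    then show "t - 3 / N n \<le> \<phi> n t" using N[of n] by (simp add: field_simps)
  qed
  have Nlim: "(\<lambda>n. 1 / N n) \<longlonglongrightarrow> 0"
    unfolding N_def using LIMSEQ_inverse_real_of_nat by (simp add: inverse_eq_divide)
  have Fnlim: "(\<lambda>n. Fn n (p + (1 / N n) *\<^sub>R y)) \<longlonglongrightarrow> f p" for y
  proof -
    let ?x = "\<lambda>n. p + (1 / N n) *\<^sub>R y"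
    have xlim: "?x \<longlonglongrightarrow> p"
      using tendsto_add[OF tendsto_const[of p] tendsto_scaleR[OF Nlim tendsto_const[of y]]] by simp
    have "isCont f p"
      using C2_jet_on_continuous(1)[OF jet] opM p(1) by (simp add: continuous_on_eq_continuous_at)
    then have flim: "(\<lambda>n. f (?x n)) \<longlonglongrightarrow> f p"
      using isCont_tendsto_compose xlim by blast
    have ev: "eventually (\<lambda>n. ?x n \<in> M \<and> f (?x n) > 0) sequentially"
      using topological_tendstoD[OF xlim opM p(1)] order_tendstoD(1)[OF flim p(2)]
      by eventually_elim auto
    show ?thesis
    proof (rule tendsto_sandwich)
      show "eventually (\<lambda>n. f (?x n) - 3 * (1 / N n) \<le> Fn n (?x n)) sequentially"
        using ev by eventually_elim (use \<phi>_bounds(3) in \<open>auto simp: Fn_def\<close>)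
      show "eventually (\<lambda>n. Fn n (?x n) \<le> f (?x n)) sequentially"
        using ev
      proof eventually_elim
        case (elim n)
        then show ?case using \<phi>_bounds(2)[of n "f (?x n)"] by (auto simp: Fn_def)
      qed
      show "(\<lambda>n. f (?x n) - 3 * (1 / N n)) \<longlonglongrightarrow> f p"
        using tendsto_diff[OF flim tendsto_mult[OF tendsto_const[of 3] Nlim]] by simp
    qed (rule flim)
  qed
  have Fnbound: "0 \<le> Fn n x" "Fn n x \<le> f p" for n x
    using \<phi>_bounds(1,2)[of n "f x"] max[of x] p(2) by (auto simp: Fn_def)
  have Llim: "L \<longlonglongrightarrow> 2 * pi * f p"
  proof -
    have base: "has_bochner_integral lborel (\<lambda>y::real^2. 2 * (1 / (1 + (norm y)\<^sup>2)\<^sup>2) * f p) (2 * pi * f p)"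
      by (intro has_bochner_integral_mult_left has_bochner_integral_mult_right has_bochner_integral_inverse_square_plane)
    have "(\<lambda>n. \<integral>y. l n y \<partial>lborel) \<longlonglongrightarrow> (\<integral>(y::real^2). 2 * (1 / (1 + (norm y)\<^sup>2)\<^sup>2) * f p \<partial>lborel)"
    proof (rule integral_dominated_convergence[where w = "\<lambda>y::real^2. 2 * (1 / (1 + (norm y)\<^sup>2)\<^sup>2) * f p"])
      show "l n \<in> borel_measurable lborel" for n
        unfolding l_def[abs_def] by measurable
      show "AE y in lborel. (\<lambda>n. l n y) \<longlonglongrightarrow> 2 * (1 / (1 + (norm y)\<^sup>2)\<^sup>2) * f p"
        unfolding l_def by (intro AE_I2 tendsto_mult_left Fnlim)
      show "AE y in lborel. norm (l n y) \<le> 2 * (1 / (1 + (norm y)\<^sup>2)\<^sup>2) * f p" for n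
      proof (rule AE_I2)
        fix y :: "real^2"
        have "\<bar>l n y\<bar> = 2 * (1 / (1 + (norm y)\<^sup>2)\<^sup>2) * Fn n (p + (1 / N n) *\<^sub>R y)"
          using Fnbound(1) by (simp add: l_def abs_mult)
        also have "\<dots> \<le> 2 * (1 / (1 + (norm y)\<^sup>2)\<^sup>2) * f p"
          using Fnbound(2) by (intro mult_left_mono) auto
        finally show "norm (l n y) \<le> 2 * (1 / (1 + (norm y)\<^sup>2)\<^sup>2) * f p" by simp
      qed
    qed (use base in \<open>auto simp: has_bochner_integral_iff\<close>)
    then show ?thesis
      using base by (simp add: L[abs_def] has_bochner_integral_iff)
  qed

  \<comment> \<open>What is left of the integrand on the other side without the term containing \<open>\<phi>''\<close>.\<close>
  define c where "c n x = indicator M x * (\<phi>' n (f x) * (- Q x / ((norm (x - p))\<^sup>2 + \<epsilon> n)))" for n x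
  have contQ: "continuous_on M Q"
  proof -
    have "continuous_on M (\<lambda>x. H x *v perp (x - p))"
      unfolding matrix_vector_mult_def using C2_jet_onD(4)[OF jet]
      by (intro continuous_on_vec_lambda continuous_intros)
    then show ?thesis unfolding Q_def[abs_def] by (intro continuous_intros)
  qed
  have meas_c: "c n \<in> borel_measurable lborel" for n
  proof -
    have "continuous_on UNIV (\<phi>' n)"
      using d\<phi>' by (auto intro!: continuous_at_imp_continuous_on DERIV_isCont)
    then have "continuous_on M (\<lambda>x. \<phi>' n (f x))"
      by (rule continuous_on_compose2) (use C2_jet_on_continuous(1)[OF jet] in auto)
    moreover have "(norm (x - p))\<^sup>2 + \<epsilon> n \<noteq> 0" for x
      using eps[of n] by (simp add: add_nonneg_eq_0_iff)
    ultimately have "continuous_on M (\<lambda>x. \<phi>' n (f x) * (- Q x / ((norm (x - p))\<^sup>2 + \<epsilon> n)))"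
      using contQ by (intro continuous_intros) auto
    then have "(\<lambda>x. indicator M x *\<^sub>R (\<phi>' n (f x) * (- Q x / ((norm (x - p))\<^sup>2 + \<epsilon> n)))) \<in> borel_measurable borel"
      using opM by (intro borel_measurable_continuous_on_indicator) auto
    then show ?thesis by (simp add: c_def[abs_def])
  qed
  have Qbound: "\<bar>Q x\<bar> \<le> A x * (norm (x - p))\<^sup>2" if "x \<in> M" for x
    using A[OF that, of "perp (x - p)"] by (simp add: Q_def)
  have A0: "0 \<le> A x" if "x \<in> M" for x
    using A[OF that, of "axis 1 1"] by (simp add: norm_axis_1)
  have c_bound: "norm (c n x) \<le> indicator M x * A x" for n x
  proof (cases "x \<in> M")
    case True
    let ?r = "(norm (x - p))\<^sup>2"
    have r: "?r + \<epsilon> n > 0" using eps[of n] by (simp add: add_nonneg_pos)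
    have "\<bar>Q x\<bar> \<le> A x * (?r + \<epsilon> n)"
      using Qbound[OF True] A0[OF True] eps[of n] by (simp add: distrib_left add_increasing2)
    then have "\<bar>Q x\<bar> / (?r + \<epsilon> n) \<le> A x" using r by (simp add: pos_divide_le_eq)
    moreover have "\<bar>c n x\<bar> = \<phi>' n (f x) * (\<bar>Q x\<bar> / (?r + \<epsilon> n))"
      using True soft_pos_bounds(1) r by (simp add: c_def abs_mult \<phi>'_def)
    moreover have "\<dots> \<le> 1 * (\<bar>Q x\<bar> / (?r + \<epsilon> n))"
      using soft_pos_bounds(2) r by (intro mult_right_mono) (auto simp: \<phi>'_def)
    ultimately show ?thesis using True by simp
  qed (simp add: c_def)
  have c_lim: "(\<lambda>n. c n x) \<longlonglongrightarrow> d x" for x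
  proof (cases "x \<in> M \<and> x \<noteq> p")
    case True
    have e0: "\<epsilon> \<longlonglongrightarrow> 0"
      unfolding \<epsilon>_def[abs_def] using tendsto_power[OF Nlim, of 2] by simp
    have "(\<lambda>n. \<phi>' n (f x) * (- Q x / ((norm (x - p))\<^sup>2 + \<epsilon> n))) \<longlonglongrightarrow>
       (if 0 < f x then 1 else 0) * (- Q x / ((norm (x - p))\<^sup>2 + 0))"
      unfolding \<phi>'_def N_def
      by (intro tendsto_mult soft_pos'_limit tendsto_divide tendsto_add tendsto_const e0) (use True in auto)
    then show ?thesis using True by (auto simp: c_def d_def Q_def indicator_def of_bool_def)
  next
    case False
    then show ?thesis by (auto simp: c_def d_def Q_def)
  qed
  have meas_d: "d \<in> borel_measurable lborel"
    by (rule borel_measurable_LIMSEQ_real[OF c_lim meas_c])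
  show "integrable lborel d"
    by (rule integrable_dominated_convergence[where s = c, OF meas_d meas_c intA]) (use c_lim c_bound in auto)
  have lim: "(\<lambda>n. integral\<^sup>L lborel (c n)) \<longlonglongrightarrow> integral\<^sup>L lborel d"
    by (rule integral_dominated_convergence[where s = c, OF meas_d meas_c intA]) (use c_lim c_bound in auto)
  have le: "L n \<le> integral\<^sup>L lborel (c n)" for n
  proof -
    \<comment> \<open>Convexity of \<open>\<phi> n\<close> enters here: the discarded term is \<open>\<phi>'' n (f x) * (g x \<bullet> perp (x - p))\<^sup>2\<close>.\<close>
    have "L n = (\<integral>x. - (perp (x - p) \<bullet> (Hn n x *v perp (x - p)) / ((norm (x - p))\<^sup>2 + \<epsilon> n)) \<partial>lborel)"
      by (simp only: L_def main(2) Bochner_Integration.integral_minus)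
    also have "\<dots> \<le> integral\<^sup>L lborel (c n)"
    proof (rule integral_mono)
      show "integrable lborel (\<lambda>x. - (perp (x - p) \<bullet> (Hn n x *v perp (x - p)) / ((norm (x - p))\<^sup>2 + \<epsilon> n)))"
        using main(1) by simp
      show "integrable lborel (c n)"
        by (rule Bochner_Integration.integrable_bound[OF intA meas_c])
          (intro AE_I2 order_trans[OF c_bound], simp)
      fix x
      let ?v = "perp (x - p)"
      have r: "(norm (x - p))\<^sup>2 + \<epsilon> n > 0" using eps[of n] by (simp add: add_nonneg_pos)
      have "?v \<bullet> (Hn n x *v ?v) = \<phi>' n (f x) * Q x + \<phi>'' n (f x) * (g x \<bullet> ?v)\<^sup>2" if "x \<in> M"
        using that unfolding Hn_def Q_def
        by (simp add: matrix_vector_mult_add_rdistrib outer_product_mult_vec inner_add_right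
            inner_commute power2_eq_square flip: scaleR_matrix_vector_assoc)
      moreover have "0 \<le> \<phi>'' n (f x) * (g x \<bullet> ?v)\<^sup>2"
        using soft_pos_bounds(3) N[of n] by (simp add: \<phi>''_def)
      ultimately have "indicator M x * (\<phi>' n (f x) * Q x) \<le> ?v \<bullet> (Hn n x *v ?v)"
        by (cases "x \<in> M") (auto simp: Hn_def)
      then have "indicator M x * (\<phi>' n (f x) * Q x) / ((norm (x - p))\<^sup>2 + \<epsilon> n) \<le> ?v \<bullet> (Hn n x *v ?v) / ((norm (x - p))\<^sup>2 + \<epsilon> n)"
        using r by (intro divide_right_mono) auto
      then show "- (?v \<bullet> (Hn n x *v ?v) / ((norm (x - p))\<^sup>2 + \<epsilon> n)) \<le> c n x"
        by (simp add: c_def)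
    qed
    finally show ?thesis .
  qed
  show "2 * pi * f p \<le> (\<integral>x. d x \<partial>lborel)"
    by (rule LIMSEQ_le[OF Llim lim]) (intro exI allI impI le)
qed

section \<open>The pointwise meaning of equality\<close>

lemma continuous_AE_zero_imp_zero:
  fixes h :: "'a::euclidean_space \<Rightarrow> real"
  assumes U: "open U" and h: "continuous_on U h" and ae: "AE x in lborel. x \<in> U \<longrightarrow> h x = 0" and x: "x \<in> U"
  shows "h x = 0"
proof (rule ccontr)
  assume "h x \<noteq> 0"
  let ?W = "U \<inter> h -` (- {0})"
  have op: "open ?W" by (rule continuous_open_preimage[OF h U]) auto
  moreover have "x \<in> ?W" using x \<open>h x \<noteq> 0\<close> by auto
  ultimately have "\<not> negligible ?W" using open_not_negligible by blast
  moreover have "AE x in lborel. x \<notin> ?W"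
    using ae by eventually_elim auto
  then have "?W \<in> null_sets lborel"
    using op by (simp add: AE_iff_null_sets)
  then have "negligible ?W"
    using negligible_iff_null_sets null_sets_completionI by blast
  ultimately show False by simp
qed

lemma matrix_opnorm_bound: "norm (A *v v) \<le> matrix_opnorm A * norm v"
  unfolding matrix_opnorm_def by (rule onorm) (rule matrix_vector_mul_bounded_linear)

lemma matrix_opnorm_nonneg: "0 \<le> matrix_opnorm A"
  unfolding matrix_opnorm_def by (rule onorm_pos_le) (rule matrix_vector_mul_bounded_linear)

lemma matrix_opnorm_quadratic_bound: "\<bar>v \<bullet> (A *v v)\<bar> \<le> matrix_opnorm A * (norm v)\<^sup>2" for A :: "real^'n^'n"
proof -
  have "\<bar>v \<bullet> (A *v v)\<bar> \<le> norm v * norm (A *v v)" by (rule Cauchy_Schwarz_ineq2)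
  also have "\<dots> \<le> norm v * (matrix_opnorm A * norm v)" by (intro mult_left_mono matrix_opnorm_bound) auto
  finally show ?thesis by (simp add: power2_eq_square mult_ac)
qed

lemma matrix_opnorm_minus: "matrix_opnorm (- A) = matrix_opnorm A"
proof -
  have "(\<lambda>v. (- A) *v v) = (\<lambda>v. - (A *v v))"
    by (simp add: fun_eq_iff vec_eq_iff matrix_vector_mult_def sum_negf)
  then show ?thesis by (simp add: matrix_opnorm_def onorm_neg)
qed

text \<open>The operator norm is the norm of the associated bounded linear function, which depends linearly on the
  matrix.\<close>
lemma continuous_on_matrix_opnorm:
  fixes H :: "'a::topological_space \<Rightarrow> real^'n^'m"
  assumes "continuous_on S H"
  shows "continuous_on S (\<lambda>x. matrix_opnorm (H x))"
proof -
  have bl: "bounded_linear (\<lambda>v. A *v v)" for A :: "real^'n^'m"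
    by (rule matrix_vector_mul_bounded_linear)
  have app: "blinfun_apply (Blinfun (\<lambda>v. A *v v)) w = A *v w" for A :: "real^'n^'m" and w
    by (simp add: bounded_linear_Blinfun_apply[OF bl])
  have "linear (\<lambda>A :: real^'n^'m. Blinfun (\<lambda>v. A *v v))"
  proof (rule linearI; rule blinfun_eqI)
    fix A B :: "real^'n^'m" and c :: real and w
    show "blinfun_apply (Blinfun (\<lambda>v. (A + B) *v v)) w
        = blinfun_apply (Blinfun (\<lambda>v. A *v v) + Blinfun (\<lambda>v. B *v v)) w"
      unfolding plus_blinfun.rep_eq app by (rule matrix_vector_mult_add_rdistrib)
    show "blinfun_apply (Blinfun (\<lambda>v. (c *\<^sub>R A) *v v)) w
        = blinfun_apply (c *\<^sub>R Blinfun (\<lambda>v. A *v v)) w"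
      unfolding scaleR_blinfun.rep_eq app by (rule scaleR_matrix_vector_assoc[symmetric])
  qed
  then have bl2: "bounded_linear (\<lambda>A :: real^'n^'m. Blinfun (\<lambda>v. A *v v))"
    by (simp add: linear_conv_bounded_linear)
  have "continuous_on S (\<lambda>x. norm (Blinfun (\<lambda>v. H x *v v)))"
    by (rule continuous_on_norm[OF bounded_linear.continuous_on[OF bl2 assms]])
  then show ?thesis
    by (simp add: matrix_opnorm_def norm_blinfun.rep_eq bounded_linear_Blinfun_apply[OF bl])
qed

text \<open>The integrands of the two sides of \<open>max_value_le_tangential_hessian_integral\<close> are ordered pointwise, so
  equal integrals make them agree almost everywhere, and continuity makes them agree everywhere on the open sets
  \<open>{f > 0} - {p}\<close> and \<open>{f < 0}\<close>.\<close>
lemma equality_imp_tangential_eigenvalue: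
  assumes jet: "C2_jet_on M f g H" and bdd: "bounded M"
    and contf: "continuous_on (closure M) f" and bd: "\<And>x. x \<in> frontier M \<Longrightarrow> f x = 0"
    and p: "p \<in> M" "f p > 0" and max: "\<And>x. x \<in> M \<Longrightarrow> f x \<le> f p"
    and eq: "has_bochner_integral lborel (\<lambda>x. indicator M x * matrix_opnorm (H x)) (2 * pi * f p)"
    and x: "x \<in> M"
  shows "f x > 0 \<Longrightarrow> perp (x - p) \<bullet> (H x *v perp (x - p)) = - matrix_opnorm (H x) * (norm (x - p))\<^sup>2"
    and "f x < 0 \<Longrightarrow> matrix_opnorm (H x) = 0"
proof -
  let ?A = "\<lambda>x. matrix_opnorm (H x)"
  define Q where "Q x = perp (x - p) \<bullet> (H x *v perp (x - p))" for x
  define d where "d x = indicator {x \<in> M. f x > 0} x * (- Q x / (norm (x - p))\<^sup>2)" for x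
  note opM = C2_jet_onD(1)[OF jet]
  have contA: "continuous_on M ?A"
    by (rule continuous_on_matrix_opnorm[OF C2_jet_onD(4)[OF jet]])
  have intA: "integrable lborel (\<lambda>x. indicator M x * ?A x)"
    and valA: "(\<integral>x. indicator M x * ?A x \<partial>lborel) = 2 * pi * f p"
    using eq by (auto simp: has_bochner_integral_iff)
  have d: "integrable lborel d" "2 * pi * f p \<le> (\<integral>x. d x \<partial>lborel)"
    using max_value_le_tangential_hessian_integral[OF jet bdd contf bd p max matrix_opnorm_quadratic_bound intA]
    by (simp_all add: d_def[abs_def] Q_def)
  have Qb: "\<bar>Q x\<bar> \<le> ?A x * (norm (x - p))\<^sup>2" for x
    using matrix_opnorm_quadratic_bound[of "perp (x - p)" "H x"] by (simp add: Q_def)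
  define e where "e x = indicator M x * ?A x - d x" for x
  have e0: "0 \<le> e x" for x
  proof (cases "x \<in> M \<and> f x > 0 \<and> x \<noteq> p")
    case True
    then have r: "(norm (x - p))\<^sup>2 > 0" by simp
    have "- Q x / (norm (x - p))\<^sup>2 \<le> ?A x"
      unfolding pos_divide_le_eq[OF r] using Qb[of x] by linarith
    then show ?thesis using True by (simp add: e_def d_def)
  next
    case False
    then show ?thesis using matrix_opnorm_nonneg by (auto simp: e_def d_def indicator_def)
  qed
  have inte: "integrable lborel e" unfolding e_def[abs_def] using intA d(1) by simp
  have "(\<integral>x. e x \<partial>lborel) = 2 * pi * f p - (\<integral>x. d x \<partial>lborel)"
    unfolding e_def using intA d(1) valA by simp
  then have "(\<integral>x. e x \<partial>lborel) = 0"
    using d(2) Bochner_Integration.integral_nonneg[of lborel e] e0 by (simp add: order_antisym)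
  then have ae: "AE x in lborel. e x = 0"
    using integral_nonneg_eq_0_iff_AE[OF inte] e0 by simp
  have op: "open {x \<in> M. f x > 0}" "open {x \<in> M. f x < 0}"
    using continuous_open_preimage[OF C2_jet_on_continuous(1)[OF jet] opM, of "{0<..}"]
      continuous_open_preimage[OF C2_jet_on_continuous(1)[OF jet] opM, of "{..<0}"]
    by (simp_all add: vimage_def Int_def)
  show "?A x = 0" if "f x < 0"
  proof (rule continuous_AE_zero_imp_zero[OF op(2)])
    show "continuous_on {x \<in> M. f x < 0} ?A" by (rule continuous_on_subset[OF contA]) auto
    show "AE x in lborel. x \<in> {x \<in> M. f x < 0} \<longrightarrow> ?A x = 0"
      using ae by eventually_elim (auto simp: e_def d_def indicator_def)
    show "x \<in> {x \<in> M. f x < 0}" using that x by simp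
  qed
  show "perp (x - p) \<bullet> (H x *v perp (x - p)) = - ?A x * (norm (x - p))\<^sup>2" if "f x > 0"
  proof (cases "x = p")
    case False
    define h where "h x = ?A x * (norm (x - p))\<^sup>2 + Q x" for x
    have "h x = 0"
    proof (rule continuous_AE_zero_imp_zero[where U = "{x \<in> M. f x > 0} - {p}"])
      let ?U = "{x \<in> M. f x > 0} - {p}"
      show "open ?U" using op(1) by (intro open_delete)
      have "continuous_on M (\<lambda>x. H x *v perp (x - p))"
        unfolding matrix_vector_mult_def using C2_jet_onD(4)[OF jet]
        by (intro continuous_on_vec_lambda continuous_intros)
      then have "continuous_on M h"
        unfolding h_def[abs_def] Q_def using contA by (intro continuous_intros)
      then show "continuous_on ?U h"
        by (rule continuous_on_subset) auto
      show "AE x in lborel. x \<in> ?U \<longrightarrow> h x = 0"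
        using ae by eventually_elim (auto simp: e_def d_def h_def field_simps)
      show "x \<in> ?U" using that x False by simp
    qed
    then show ?thesis by (simp add: h_def Q_def)
  qed simp
qed

section \<open>Domains with a tangential extremal eigenvalue\<close>

lemma inner_perp_self [simp]: "v \<bullet> perp v = 0"
  by (simp add: inner_vec2)

lemma perp_perp [simp]: "perp (perp v) = - v"
  by (simp add: vec_eq_iff forall_2)

text \<open>With \<open>a\<close> the operator norm of \<open>A\<close>, expanding the square gives
  \<open>\<bar>A v + a v\<bar>\<^sup>2 \<le> a\<^sup>2 \<bar>v\<bar>\<^sup>2 - 2 a\<^sup>2 \<bar>v\<bar>\<^sup>2 + a\<^sup>2 \<bar>v\<bar>\<^sup>2 = 0\<close>.\<close>
lemma extremal_quadratic_form_imp_eigenvector: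
  fixes A :: "real^'n^'n"
  assumes "v \<bullet> (A *v v) = - matrix_opnorm A * (norm v)\<^sup>2"
  shows "A *v v = - (matrix_opnorm A *\<^sub>R v)"
proof -
  let ?a = "matrix_opnorm A"
  have sq: "(norm (x + y))\<^sup>2 = (norm x)\<^sup>2 + 2 * (x \<bullet> y) + (norm y)\<^sup>2" for x y :: "real^'n"
    by (simp add: power2_norm_eq_inner inner_add_left inner_add_right inner_commute)
  have "(norm (A *v v))\<^sup>2 \<le> (?a * norm v)\<^sup>2"
    by (intro power_mono matrix_opnorm_bound) simp
  moreover have "(norm (A *v v + ?a *\<^sub>R v))\<^sup>2 = (norm (A *v v))\<^sup>2 + 2 * ?a * (v \<bullet> (A *v v)) + (?a * norm v)\<^sup>2"
    using sq[of "A *v v" "?a *\<^sub>R v"] by (simp add: power_mult_distrib inner_commute)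
  ultimately have "(norm (A *v v + ?a *\<^sub>R v))\<^sup>2 \<le> 0"
    using assms by (simp add: power2_eq_square algebra_simps)
  then have "A *v v + ?a *\<^sub>R v = 0" by simp
  then show ?thesis by (simp add: eq_neg_iff_add_eq_0)
qed

text \<open>The product rule for the angular derivative of \<open>f\<close> about \<open>p\<close>; it is taken in coordinates because the
  derivative of \<open>g\<close> is available only against fixed vectors.\<close>
lemma C2_jet_on_angular_derivative:
  assumes "C2_jet_on M f g H" and "x \<in> M"
  shows "((\<lambda>y. g y \<bullet> perp (y - p)) has_derivative
    (\<lambda>h. h \<bullet> (H x *v perp (x - p)) + g x \<bullet> perp h)) (at x)"
proof -
  have d: "((\<lambda>y. (y - p) $ i) has_derivative (\<lambda>h. h $ i)) (at x)" for i
    by (auto intro!: derivative_eq_intros bounded_linear_imp_has_derivative)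
  have "((\<lambda>y. (y - p) $ 1 * (g y \<bullet> axis 2 1) - (y - p) $ 2 * (g y \<bullet> axis 1 1)) has_derivative
     (\<lambda>h. ((x - p) $ 1 * (h \<bullet> (H x *v axis 2 1)) + h $ 1 * (g x \<bullet> axis 2 1))
        - ((x - p) $ 2 * (h \<bullet> (H x *v axis 1 1)) + h $ 2 * (g x \<bullet> axis 1 1)))) (at x)"
    by (intro has_derivative_diff has_derivative_mult d C2_jet_onD(3)[OF assms])
  moreover have "(\<lambda>y. (y - p) $ 1 * (g y \<bullet> axis 2 1) - (y - p) $ 2 * (g y \<bullet> axis 1 1)) = (\<lambda>y. g y \<bullet> perp (y - p))"
    by (simp add: inner_vec2 axis_def fun_eq_iff algebra_simps)
  moreover have "(\<lambda>h. ((x - p) $ 1 * (h \<bullet> (H x *v axis 2 1)) + h $ 1 * (g x \<bullet> axis 2 1))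
        - ((x - p) $ 2 * (h \<bullet> (H x *v axis 1 1)) + h $ 2 * (g x \<bullet> axis 1 1)))
     = (\<lambda>h. h \<bullet> (H x *v perp (x - p)) + g x \<bullet> perp h)"
    by (simp add: inner_vec2 axis_def fun_eq_iff matrix_vector_mult_def sum_2) (simp add: algebra_simps)
  ultimately show ?thesis by simp
qed

lemma C2_jet_on_line:
  assumes "C2_jet_on M f g H" and "p + t *\<^sub>R u \<in> M"
  shows "((\<lambda>t. f (p + t *\<^sub>R u)) has_real_derivative g (p + t *\<^sub>R u) \<bullet> u) (at t)"
    and "((\<lambda>t. g (p + t *\<^sub>R u) \<bullet> v) has_real_derivative u \<bullet> (H (p + t *\<^sub>R u) *v v)) (at t)"
proof -
  have l: "((\<lambda>t. p + t *\<^sub>R u) has_derivative (\<lambda>s. s *\<^sub>R u)) (at t)"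
    by (auto intro!: derivative_eq_intros)
  show "((\<lambda>t. f (p + t *\<^sub>R u)) has_real_derivative g (p + t *\<^sub>R u) \<bullet> u) (at t)"
    using has_derivative_compose[OF l C2_jet_onD(2)[OF assms]]
    by (simp add: has_field_derivative_def mult_commute_abs)
  show "((\<lambda>t. g (p + t *\<^sub>R u) \<bullet> v) has_real_derivative u \<bullet> (H (p + t *\<^sub>R u) *v v)) (at t)"
    using has_derivative_compose[OF l C2_jet_onD(3)[OF assms, of v]]
    by (simp add: has_field_derivative_def mult_commute_abs)
qed

lemma radial_if_angular_derivative_zero:
  assumes der: "\<And>x. x \<in> ball p R \<Longrightarrow> (f has_derivative (\<lambda>h. g x \<bullet> h)) (at x)"
    and ang: "\<And>x. x \<in> ball p R \<Longrightarrow> g x \<bullet> perp (x - p) = 0"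
    and xy: "x \<in> ball p R" "norm (x - p) = norm (y - p)"
  shows "f x = f y"
proof -
  define r where "r = norm (x - p)"
  define c :: "real \<Rightarrow> real^2" where "c \<theta> = p + r *\<^sub>R (cos \<theta> *\<^sub>R axis 1 1 + sin \<theta> *\<^sub>R axis 2 1)" for \<theta>
  have c_perp: "perp (c \<theta> - p) = r *\<^sub>R (- sin \<theta> *\<^sub>R axis 1 1 + cos \<theta> *\<^sub>R axis 2 1)" for \<theta>
    by (simp add: c_def vec_eq_iff forall_2 axis_def)
  have onto: "\<exists>\<theta>. z = c \<theta>" if z: "norm (z - p) = r" for z
  proof (cases "r = 0")
    case True
    then show ?thesis using z by (simp add: c_def)
  next
    case False
    have "((z - p) $ 1)\<^sup>2 + ((z - p) $ 2)\<^sup>2 = r\<^sup>2"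
      using z by (metis power2_norm_eq_inner inner_vec2 power2_eq_square)
    then have "((z - p) $ 1 / r)\<^sup>2 + ((z - p) $ 2 / r)\<^sup>2 = 1"
      using False by (simp add: power_divide flip: add_divide_distrib)
    then obtain \<theta> where "(z - p) $ 1 / r = cos \<theta>" "(z - p) $ 2 / r = sin \<theta>"
      by (rule sincos_total_2pi)
    then have "(z - p) $ 1 = r * cos \<theta>" "(z - p) $ 2 = r * sin \<theta>"
      using False by (simp_all add: field_simps)
    then have "z = c \<theta>"
      by (simp add: c_def vec_eq_iff forall_2 axis_def algebra_simps)
    then show ?thesis ..
  qed
  have cball: "c \<theta> \<in> ball p R" for \<theta>
  proof -
    have "(norm (c \<theta> - p))\<^sup>2 = (r * cos \<theta>)\<^sup>2 + (r * sin \<theta>)\<^sup>2"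
      unfolding power2_norm_eq_inner inner_vec2
      by (simp add: c_def axis_def power2_eq_square)
    also have "\<dots> = r\<^sup>2 * ((cos \<theta>)\<^sup>2 + (sin \<theta>)\<^sup>2)"
      by (simp only: power_mult_distrib distrib_left)
    finally have "norm (c \<theta> - p) = r"
      by (simp add: r_def)
    then show ?thesis using xy(1) by (simp add: r_def dist_norm norm_minus_commute)
  qed
  have "((\<lambda>\<theta>. f (c \<theta>)) has_real_derivative 0) (at \<theta>)" for \<theta>
  proof -
    have "(c has_derivative (\<lambda>s. s *\<^sub>R perp (c \<theta> - p))) (at \<theta>)"
      unfolding c_perp unfolding c_def[abs_def]
      by (auto intro!: derivative_eq_intros simp: algebra_simps)
    from has_derivative_compose[OF this der[OF cball]] show ?thesis
      using ang[OF cball] by (simp add: has_field_derivative_def lambda_zero)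
  qed
  then have "f (c s) = f (c t)" for s t
    by (intro DERIV_isconst_all) auto
  moreover obtain s t where "x = c s" "y = c t"
    using onto[of x] onto[of y] xy(2) by (auto simp: r_def)
  ultimately show ?thesis by simp
qed

text \<open>The extremal tangential eigenvalue makes \<open>f\<close> radial on the largest disc about \<open>p\<close> on which it is
  positive. As positivity fails at some point \<open>q\<close> of the bounding circle, \<open>f\<close> vanishes on that circle, and the
  circle misses \<open>M\<close>; a connected set that meets the disc and misses its boundary lies inside it.\<close>
lemma domain_is_disc_of_tangential_eigenvalue:
  assumes jet: "C2_jet_on M f g H" and bdd: "bounded M" and conn: "connected M"
    and contf: "continuous_on (closure M) f" and bd: "\<And>x. x \<in> frontier M \<Longrightarrow> f x = 0"
    and p: "p \<in> M" "f p > 0" and max: "\<And>x. x \<in> M \<Longrightarrow> f x \<le> f p"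
    and eig: "\<And>x. x \<in> M \<Longrightarrow> f x > 0 \<Longrightarrow>
        perp (x - p) \<bullet> (H x *v perp (x - p)) = - matrix_opnorm (H x) * (norm (x - p))\<^sup>2"
    and neg: "\<And>x. x \<in> M \<Longrightarrow> f x < 0 \<Longrightarrow> matrix_opnorm (H x) = 0"
  shows "\<exists>R>0. M = ball p R"
proof -
  note opM = C2_jet_onD(1)[OF jet]
  note contM = C2_jet_on_continuous[OF jet]
  let ?A = "\<lambda>x. matrix_opnorm (H x)"
  have contA: "continuous_on M ?A"
    by (rule continuous_on_matrix_opnorm[OF C2_jet_onD(4)[OF jet]])
  define P where "P = {x \<in> M. f x > 0}"
  have opP: "open P"
    using continuous_open_preimage[OF contM(1) opM, of "{0<..}"] by (simp add: vimage_def Int_def P_def)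
  have "closed (- P)" by (rule closed_Compl[OF opP])
  moreover have "- P \<noteq> {}"
  proof
    assume "- P = {}"
    then have "UNIV \<subseteq> M" by (auto simp: P_def)
    then show False using bounded_subset[OF bdd, of UNIV] not_bounded_UNIV by blast
  qed
  ultimately obtain q where q: "q \<in> - P" "infdist p (- P) = dist p q"
    by (rule infdist_attains_inf)
  define R where "R = dist p q"
  have R: "R > 0" using q p by (auto simp: R_def P_def)
  have ballP: "ball p R \<subseteq> P"
  proof
    fix x assume "x \<in> ball p R"
    then show "x \<in> P"
      using infdist_le[of x "- P" p] q(2) by (force simp: R_def)
  qed
  then have ballM: "ball p R \<subseteq> M" by (auto simp: P_def)
  then have cballM: "cball p R \<subseteq> closure M"
    using closure_mono[OF ballM] R by simp
  have ray: "p + t *\<^sub>R u \<in> ball p R" if "0 \<le> t" "t < 1" "norm u \<le> R" for t u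
  proof -
    have "t * norm u \<le> t * R" using that by (intro mult_left_mono) auto
    also have "\<dots> < R" using that R by simp
    finally show ?thesis using that by (simp add: dist_norm)
  qed
  have gp: "g p = 0"
  proof -
    have "(\<lambda>h. g p \<bullet> h) = (\<lambda>h. 0)"
      using differential_zero_maxmin[OF p(1) opM C2_jet_onD(2)[OF jet p(1)]] max by blast
    then show ?thesis by (metis inner_eq_zero_iff)
  qed
  \<comment> \<open>Along the ray through \<open>x\<close> the Hessian maps \<open>perp u\<close> to a multiple of itself, which is orthogonal to \<open>u\<close>;
    so \<open>g \<bullet> perp u\<close> is constant on the ray, and it is zero at \<open>p\<close>.\<close>
  have angular: "g x \<bullet> perp (x - p) = 0" if x: "x \<in> ball p R" for x
  proof -
    define u where "u = x - p"
    let ?k = "\<lambda>t. g (p + t *\<^sub>R u) \<bullet> perp u"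
    have on: "p + t *\<^sub>R u \<in> P" if "0 \<le> t" "t \<le> 1" for t
    proof -
      have "t * norm u \<le> norm u" using that by (simp add: mult_left_le_one_le)
      then have "p + t *\<^sub>R u \<in> ball p R"
        using x that by (simp add: dist_norm u_def norm_minus_commute)
      then show ?thesis using ballP by blast
    qed
    have der: "(?k has_real_derivative u \<bullet> (H (p + t *\<^sub>R u) *v perp u)) (at t)" if "0 \<le> t" "t \<le> 1" for t
      using C2_jet_on_line(2)[OF jet] on[OF that] by (simp add: P_def)
    have "?k 1 = ?k 0"
    proof (rule DERIV_isconst2[of 0 1])
      show "continuous_on {0..1} ?k"
        using der by (intro continuous_at_imp_continuous_on ballI) (auto intro: DERIV_isCont)
      fix t :: real assume t: "0 < t" "t < 1"
      let ?y = "p + t *\<^sub>R u"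
      have "H ?y *v perp (?y - p) = - (?A ?y *\<^sub>R perp (?y - p))"
        using on[of t] t eig[of ?y] by (intro extremal_quadratic_form_imp_eigenvector) (auto simp: P_def)
      then have "t *\<^sub>R (H ?y *v perp u) = t *\<^sub>R (- (?A ?y *\<^sub>R perp u))"
        by (simp add: matrix_vector_mult_scaleR mult.commute)
      then have "H ?y *v perp u = - (?A ?y *\<^sub>R perp u)"
        using t by (simp only: scaleR_cancel_left) simp
      then show "(?k has_real_derivative 0) (at t)"
        using der[of t] t by simp
    qed auto
    then show ?thesis using gp by (simp add: u_def)
  qed
  \<comment> \<open>Differentiating the angular derivative once more in the angular direction relates the radial derivative to
    the tangential eigenvalue.\<close>
  have radial_curvature: "g x \<bullet> (x - p) = - ?A x * (norm (x - p))\<^sup>2" if x: "x \<in> ball p R" for x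
  proof -
    have xM: "x \<in> M" "f x > 0" using x ballP by (auto simp: P_def)
    have "((\<lambda>y. 0) has_derivative (\<lambda>h. h \<bullet> (H x *v perp (x - p)) + g x \<bullet> perp h)) (at x)"
      using has_derivative_transform_within_open[OF C2_jet_on_angular_derivative[OF jet xM(1)] open_ball x] angular
      by auto
    then have "(\<lambda>h. h \<bullet> (H x *v perp (x - p)) + g x \<bullet> perp h) = (\<lambda>h. 0)"
      using has_derivative_unique has_derivative_const by blast
    from fun_cong[OF this, of "perp (x - p)"] show ?thesis
      using eig[OF xM] by (simp add: inner_diff_right)
  qed
  have fq: "f q = 0"
  proof -
    have qcl: "q \<in> closure M" using cballM by (auto simp: R_def)
    have "f q \<le> 0" using q(1) qcl bd[of q] opM by (auto simp: P_def frontier_def interior_open)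
    moreover have "f q \<ge> 0"
    proof (rule continuous_ge_on_closure[of "ball p R" f])
      show "continuous_on (closure (ball p R)) f"
        using contf by (rule continuous_on_subset) (use cballM R in simp)
      show "q \<in> closure (ball p R)" using R by (simp add: R_def)
      show "\<And>x. x \<in> ball p R \<Longrightarrow> 0 \<le> f x" using ballP by (force simp: P_def)
    qed
    ultimately show ?thesis by simp
  qed
  have sphere0: "f y = 0" if y: "y \<in> sphere p R" for y
  proof -
    have lim: "((\<lambda>t. f (p + t *\<^sub>R (z - p))) \<longlongrightarrow> f z) (at_left 1)" if z: "z \<in> sphere p R" for z
    proof -
      have "continuous_on {0..1} (\<lambda>t. f (p + t *\<^sub>R (z - p)))"
      proof (rule continuous_on_compose2[OF contf])
        show "(\<lambda>t. p + t *\<^sub>R (z - p)) ` {0..1} \<subseteq> closure M"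
          using z R cballM
          by (auto intro!: subsetD[OF cballM] simp: dist_norm norm_minus_commute mult_left_le_one_le)
      qed (intro continuous_intros)
      from this[unfolded continuous_on_def, rule_format, of 1] show ?thesis
        by (simp add: at_within_Icc_at_left)
    qed
    have qs: "q \<in> sphere p R" by (simp add: R_def)
    have "eventually (\<lambda>t. f (p + t *\<^sub>R (q - p)) = f (p + t *\<^sub>R (y - p))) (at_left (1::real))"
    proof (rule eventually_at_leftI[of 0])
      fix t :: real assume t: "t \<in> {0<..<1}"
      show "f (p + t *\<^sub>R (q - p)) = f (p + t *\<^sub>R (y - p))"
      proof (rule radial_if_angular_derivative_zero[where p = p and R = R and g = g])
        show "(f has_derivative (\<lambda>h. g x \<bullet> h)) (at x)" if "x \<in> ball p R" for x
          using C2_jet_onD(2)[OF jet] ballM that by blast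
        show "p + t *\<^sub>R (q - p) \<in> ball p R"
          using t qs by (intro ray) (auto simp: dist_norm norm_minus_commute)
        show "norm (p + t *\<^sub>R (q - p) - p) = norm (p + t *\<^sub>R (y - p) - p)"
          using qs y by (simp add: dist_norm norm_minus_commute)
      qed (rule angular)
    qed simp
    with lim[OF qs] have "((\<lambda>t. f (p + t *\<^sub>R (y - p))) \<longlongrightarrow> f q) (at_left 1)"
      by (rule Lim_transform_eventually)
    with lim[OF y] have "f y = f q"
      by (intro tendsto_unique[where F = "at_left (1::real)"]) auto
    then show ?thesis using fq by simp
  qed
  \<comment> \<open>The function \<open>f\<close> is examined along the radius from \<open>p\<close> to a hypothetical common point \<open>y\<close>, with \<open>t = 1\<close> at \<open>y\<close>.\<close>
  have sphereM: "y \<notin> M" if y: "y \<in> sphere p R" for y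
  proof
    assume yM: "y \<in> M"
    define u where "u = y - p"
    have nu: "norm u = R" using y by (simp add: u_def dist_norm norm_minus_commute)
    have on: "p + t *\<^sub>R u \<in> M" if "0 \<le> t" "t \<le> 1" for t
      using ray[of t u] nu ballM yM that by (cases "t = 1") (auto simp: u_def)
    let ?k' = "\<lambda>t. g (p + t *\<^sub>R u) \<bullet> u"
    let ?a = "\<lambda>t. ?A (p + t *\<^sub>R u)"
    have dk: "((\<lambda>t. f (p + t *\<^sub>R u)) has_real_derivative ?k' t) (at t)"
      and dk': "(?k' has_real_derivative u \<bullet> (H (p + t *\<^sub>R u) *v u)) (at t)" if "0 \<le> t" "t \<le> 1" for t
      using C2_jet_on_line[OF jet on[OF that]] by auto
    have cont_a: "isCont ?a 1"
    proof -
      have "isCont ?A (p + 1 *\<^sub>R u)"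
        using contA opM on[of 1] by (simp add: continuous_on_eq_continuous_at)
      moreover have "isCont (\<lambda>t. p + t *\<^sub>R u) 1" by (intro continuous_intros)
      ultimately show ?thesis by (rule isCont_o2[rotated])
    qed
    have slope: "?k' t = - ?a t * t * R\<^sup>2" if t: "0 < t" "t < 1" for t
    proof -
      have "t * ?k' t = t * (- ?a t * t * R\<^sup>2)"
        using radial_curvature[OF ray[of t u]] t nu
        by (simp add: power_mult_distrib power2_eq_square)
      moreover have "t \<noteq> 0" using t by simp
      ultimately show ?thesis by (metis mult_cancel_left)
    qed
    have slope1: "?k' 1 = - ?a 1 * R\<^sup>2"
    proof (rule tendsto_unique[where F = "at_left (1::real)"])
      show "(?k' \<longlongrightarrow> ?k' 1) (at_left 1)"
        using DERIV_isCont[OF dk'[of 1]] by (simp add: isCont_def filterlim_at_split)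
      have "((\<lambda>t. - ?a t * t * R\<^sup>2) \<longlongrightarrow> - ?a 1 * 1 * R\<^sup>2) (at_left 1)"
        using cont_a by (intro tendsto_intros) (simp add: isCont_def filterlim_at_split)
      moreover have "eventually (\<lambda>t. - ?a t * t * R\<^sup>2 = ?k' t) (at_left 1)"
        by (rule eventually_at_leftI[of 0]) (use slope in auto)
      ultimately show "(?k' \<longlongrightarrow> - ?a 1 * R\<^sup>2) (at_left 1)"
        by (simp add: Lim_transform_eventually)
    qed simp
    show False
    proof (cases "?a 1 = 0")
      case False
      \<comment> \<open>Then \<open>f < 0\<close> just beyond \<open>y\<close>, where the Hessian vanishes.\<close>
      then have "?a 1 > 0" using matrix_opnorm_nonneg[of "H (p + 1 *\<^sub>R u)"] by linarith
      then have "?k' 1 < 0" using R slope1 by (simp add: zero_less_mult_iff)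
      then obtain \<delta> where \<delta>: "\<delta> > 0" "\<And>h. 0 < h \<Longrightarrow> h < \<delta> \<Longrightarrow> f (p + (1 + h) *\<^sub>R u) < f (p + 1 *\<^sub>R u)"
        using DERIV_neg_dec_right[OF dk[of 1]] by auto
      have "p + 1 *\<^sub>R u = y" by (simp add: u_def)
      then have f1: "f (p + 1 *\<^sub>R u) = 0" using sphere0[OF y] by simp
      have "((\<lambda>t. p + t *\<^sub>R u) \<longlongrightarrow> p + 1 *\<^sub>R u) (at_right 1)" by (intro tendsto_intros)
      then have "eventually (\<lambda>t. p + t *\<^sub>R u \<in> M) (at_right 1)"
        using opM on[of 1] by (intro topological_tendstoD) auto
      moreover have "eventually (\<lambda>t. f (p + t *\<^sub>R u) < 0) (at_right 1)"
      proof (rule eventually_at_rightI[of 1 "1 + \<delta>"])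
        show "f (p + t *\<^sub>R u) < 0" if "t \<in> {1<..<1 + \<delta>}" for t
          using \<delta>(2)[of "t - 1"] f1 that by simp
      qed (use \<delta> in simp)
      ultimately have "eventually (\<lambda>t. ?a t = 0) (at_right 1)"
        by eventually_elim (rule neg)
      then have "(?a \<longlongrightarrow> 0) (at_right 1)"
        by (simp add: tendsto_eventually)
      moreover have "(?a \<longlongrightarrow> ?a 1) (at_right 1)"
        using cont_a by (simp add: isCont_def filterlim_at_split)
      ultimately have "?a 1 = 0"
        using tendsto_unique[of "at_right (1::real)"] by fastforce
      with False show False by simp
    next
      case True
      then have k1: "?k' 1 = 0" using slope1 by simp
      \<comment> \<open>The function \<open>t * ?k' t\<close> is nonpositive, nonincreasing, and zero at \<open>t = 1\<close>, hence zero throughout.\<close>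
      have d\<psi>: "((\<lambda>t. t * ?k' t) has_real_derivative (t * (u \<bullet> (H (p + t *\<^sub>R u) *v u)) + 1 * ?k' t)) (at t)"
        if "0 \<le> t" "t \<le> 1" for t
        using DERIV_mult[OF DERIV_ident dk'[OF that]] by (simp add: algebra_simps)
      have \<psi>: "t * (u \<bullet> (H (p + t *\<^sub>R u) *v u)) + 1 * ?k' t \<le> 0" if "0 < t" "t \<le> 1" for t
      proof -
        have "?k' t = - ?a t * t * R\<^sup>2" using slope[of t] slope1 that by (cases "t = 1") auto
        moreover have "u \<bullet> (H (p + t *\<^sub>R u) *v u) \<le> ?a t * R\<^sup>2"
          using matrix_opnorm_quadratic_bound[of u "H (p + t *\<^sub>R u)"] nu by simp
        then have "t * (u \<bullet> (H (p + t *\<^sub>R u) *v u)) \<le> t * (?a t * R\<^sup>2)"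
          using that by (intro mult_left_mono) auto
        ultimately show ?thesis by (simp add: mult_ac)
      qed
      have "?k' t = 0" if t: "0 < t" "t < 1" for t
      proof -
        have "1 * ?k' 1 \<le> t * ?k' t"
        proof (rule DERIV_nonpos_imp_nonincreasing[of t 1 "\<lambda>t. t * ?k' t"])
          fix s assume "t \<le> s" "s \<le> 1"
          then show "\<exists>y. ((\<lambda>t. t * ?k' t) has_real_derivative y) (at s) \<and> y \<le> 0"
            using d\<psi>[of s] \<psi>[of s] t by force
        qed (use t in simp)
        then have "0 \<le> ?k' t" using k1 t by (simp add: zero_le_mult_iff)
        moreover have "?k' t \<le> 0"
          using slope[OF t] t by (simp add: matrix_opnorm_nonneg)
        ultimately show ?thesis by simp
      qed
      then have "((\<lambda>t. f (p + t *\<^sub>R u)) has_real_derivative 0) (at t)" if "0 < t" "t < 1" for t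
        using dk[of t] that by simp
      moreover have "continuous_on {0..1} (\<lambda>t. f (p + t *\<^sub>R u))"
        using dk by (intro continuous_at_imp_continuous_on ballI) (auto intro: DERIV_isCont)
      ultimately have "f (p + 1 *\<^sub>R u) = f (p + 0 *\<^sub>R u)"
        by (intro DERIV_isconst2[of 0 1 "\<lambda>t. f (p + t *\<^sub>R u)"]) auto
      then show False using sphere0[OF y] p(2) by (simp add: u_def)
    qed
  qed
  have "M - ball p R = {}"
  proof (rule ccontr)
    assume "M - ball p R \<noteq> {}"
    moreover have "M \<inter> ball p R \<noteq> {}" using p(1) R by auto
    ultimately have "M \<inter> frontier (ball p R) \<noteq> {}"
      using connected_Int_frontier[OF conn] by blast
    then show False using sphereM R by auto
  qed
  then show ?thesis using ballM R by blast
qed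

section \<open>The rigidity theorem\<close>

lemma differentiable_imp_has_derivative_gradient:
  fixes f :: "real^'n \<Rightarrow> real"
  assumes "f differentiable (at x)"
  shows "(f has_derivative (\<lambda>h. (\<chi> i. partial_deriv i f x) \<bullet> h)) (at x)"
proof -
  let ?D = "frechet_derivative f (at x)"
  have D: "(f has_derivative ?D) (at x)"
    using assms by (simp add: frechet_derivative_works)
  then have lin: "linear ?D" by (rule has_derivative_linear)
  have "?D h = (\<chi> i. partial_deriv i f x) \<bullet> h" for h
  proof -
    have "?D h = ?D (\<Sum>i\<in>UNIV. h $ i *\<^sub>R axis i 1)"
      using basis_expansion[of h] by (simp add: scalar_mult_eq_scaleR)
    also have "\<dots> = (\<Sum>i\<in>UNIV. h $ i * partial_deriv i f x)"
      by (simp add: linear_sum[OF lin] linear_scale[OF lin] partial_deriv_def)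
    finally show ?thesis by (simp add: inner_vec_def mult.commute)
  qed
  then have "?D = (\<lambda>h. (\<chi> i. partial_deriv i f x) \<bullet> h)" by blast
  with D show ?thesis by simp
qed

lemma Ck_on_3_imp_C2_jet_on:
  fixes f :: "real^2 \<Rightarrow> real"
  assumes "open M" "Ck_on 3 M f"
  shows "C2_jet_on M f (\<lambda>x. \<chi> i. partial_deriv i f x) (hessian f)"
proof -
  have d1: "f differentiable (at x)" if "x \<in> M" for x
    using assms(2) that by (simp add: numeral_3_eq_3)
  have d2: "partial_deriv i f differentiable (at x)" if "x \<in> M" for x i
    using assms(2) that by (simp add: numeral_3_eq_3)
  have d3: "partial_deriv j (partial_deriv i f) differentiable (at x)" if "x \<in> M" for x i j
    using assms(2) that by (simp add: numeral_3_eq_3)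
  show ?thesis
    unfolding C2_jet_on_def
  proof (intro conjI ballI allI)
    fix x and v :: "real^2" assume x: "x \<in> M"
    show "(f has_derivative (\<lambda>h. (\<chi> i. partial_deriv i f x) \<bullet> h)) (at x)"
      by (rule differentiable_imp_has_derivative_gradient[OF d1[OF x]])
    have "((\<lambda>y. partial_deriv 1 f y * v $ 1 + partial_deriv 2 f y * v $ 2) has_derivative
      (\<lambda>h. ((\<chi> i. partial_deriv i (partial_deriv 1 f) x) \<bullet> h) * v $ 1
         + ((\<chi> i. partial_deriv i (partial_deriv 2 f) x) \<bullet> h) * v $ 2)) (at x)"
      by (intro has_derivative_add has_derivative_mult_left differentiable_imp_has_derivative_gradient d2 x)
    then show "((\<lambda>y. (\<chi> i. partial_deriv i f y) \<bullet> v) has_derivative (\<lambda>h. h \<bullet> (hessian f x *v v))) (at x)"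
      by (simp add: inner_vec2 hessian_def matrix_vector_mult_def sum_2 algebra_simps)
  next
    have "continuous_on M (\<lambda>x. partial_deriv i (partial_deriv j f) x)" for i j
      using d3 by (intro continuous_at_imp_continuous_on ballI differentiable_imp_continuous_within)
    then show "continuous_on M (hessian f)"
      unfolding hessian_def[abs_def] by (intro continuous_on_vec_lambda)
  qed (rule assms(1))
qed

lemma domain_is_disc_of_equality:
  assumes jet: "C2_jet_on M f g H" and bdd: "bounded M" and conn: "connected M"
    and contf: "continuous_on (closure M) f" and bd: "\<And>x. x \<in> frontier M \<Longrightarrow> f x = 0"
    and p: "p \<in> M" "f p > 0" and max: "\<And>x. x \<in> M \<Longrightarrow> f x \<le> f p"
    and eq: "has_bochner_integral lborel (\<lambda>x. indicator M x * matrix_opnorm (H x)) (2 * pi * f p)"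
  shows "\<exists>R>0. M = ball p R"
  by (rule domain_is_disc_of_tangential_eigenvalue[OF jet bdd conn contf bd p max])
    (use equality_imp_tangential_eigenvalue[OF jet bdd contf bd p max eq] in blast)+

theorem theorem1p1:
  fixes M :: "(real^2) set" and f :: "real^2 \<Rightarrow> real"
  assumes "M \<noteq> {}" and "open M" and "connected M" and "bounded M"
    and "f \<in> Ck0 3 M"
    and "\<not> f constant_on closure M"
    and "ennreal (SUP x\<in>M. \<bar>f x\<bar>) =
           ennreal (1 / (2 * pi)) * (\<integral>\<^sup>+x\<in>M. ennreal (matrix_opnorm (hessian f x)) \<partial>lborel)"
  shows "\<exists>p R. R > 0 \<and> M = ball p R"
proof -
  let ?g = "\<lambda>x. \<chi> i. partial_deriv i f x"
  have contf: "continuous_on (closure M) f" and Ck: "Ck_on 3 M f"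
    and bd: "\<And>x. x \<in> frontier M \<Longrightarrow> f x = 0"
    using assms(5) by (auto simp: Ck0_def)
  have jet: "C2_jet_on M f ?g (hessian f)"
    by (rule Ck_on_3_imp_C2_jet_on[OF assms(2) Ck])
  have cpt: "compact (closure M)" using assms(4) by (simp add: compact_closure)
  have "continuous_on (closure M) (\<lambda>x. \<bar>f x\<bar>)" using contf by (intro continuous_intros)
  then obtain p where p: "p \<in> closure M" "\<And>x. x \<in> closure M \<Longrightarrow> \<bar>f x\<bar> \<le> \<bar>f p\<bar>"
    using continuous_attains_sup[OF cpt, of "\<lambda>x. \<bar>f x\<bar>"] assms(1) by auto
  have fp: "\<bar>f p\<bar> > 0"
  proof (rule ccontr)
    assume "\<not> \<bar>f p\<bar> > 0"
    then have "\<And>x. x \<in> closure M \<Longrightarrow> f x = 0" using p(2) by force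
    then show False using assms(6) by (auto simp: constant_on_def)
  qed
  then have "p \<notin> frontier M" using bd by force
  then have pM: "p \<in> M" using p(1) assms(2) by (simp add: frontier_def interior_open)
  have le: "\<bar>f x\<bar> \<le> \<bar>f p\<bar>" if "x \<in> M" for x
    using p(2) that closure_subset by blast
  have sup: "(SUP x\<in>M. \<bar>f x\<bar>) = \<bar>f p\<bar>"
    using pM le by (intro cSup_eq_maximum) auto
  have int: "has_bochner_integral lborel (\<lambda>x. indicator M x * matrix_opnorm (hessian f x)) (2 * pi * \<bar>f p\<bar>)"
  proof (rule has_bochner_integral_nn_integral)
    have "(\<lambda>x. indicator M x *\<^sub>R matrix_opnorm (hessian f x)) \<in> borel_measurable borel"
      using assms(2) continuous_on_matrix_opnorm[OF C2_jet_onD(4)[OF jet]]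
      by (intro borel_measurable_continuous_on_indicator) auto
    then show "(\<lambda>x. indicator M x * matrix_opnorm (hessian f x)) \<in> borel_measurable lborel" by simp
    let ?I = "\<integral>\<^sup>+x\<in>M. ennreal (matrix_opnorm (hessian f x)) \<partial>lborel"
    have "ennreal (2 * pi * \<bar>f p\<bar>) = ennreal (2 * pi) * (ennreal (1 / (2 * pi)) * ?I)"
      using assms(7) by (simp add: sup ennreal_mult')
    also have "\<dots> = ennreal (2 * pi * (1 / (2 * pi))) * ?I"
      by (subst ennreal_mult') (simp_all add: mult.assoc)
    also have "2 * pi * (1 / (2 * pi)) = 1" by simp
    also have "ennreal 1 * ?I = (\<integral>\<^sup>+x. ennreal (indicator M x * matrix_opnorm (hessian f x)) \<partial>lborel)"
      by (auto intro!: nn_integral_cong simp: indicator_def)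
    finally show "(\<integral>\<^sup>+x. ennreal (indicator M x * matrix_opnorm (hessian f x)) \<partial>lborel) = ennreal (2 * pi * \<bar>f p\<bar>)" ..
  qed (auto simp: matrix_opnorm_nonneg)
  have "\<exists>R>0. M = ball p R"
  proof (cases "f p > 0")
    case True
    show ?thesis
    proof (rule domain_is_disc_of_equality[OF jet assms(4,3) contf bd pM True])
      show "f x \<le> f p" if "x \<in> M" for x using le[OF that] True by simp
    qed (use int True in simp_all)
  next
    case False
    then have neg: "- f p > 0" using fp by simp
    show ?thesis
    proof (rule domain_is_disc_of_equality[OF C2_jet_on_minus[OF jet] assms(4,3) _ _ pM])
      show "continuous_on (closure M) (\<lambda>x. - f x)" using contf by (intro continuous_intros)
      show "- f x = 0" if "x \<in> frontier M" for x using bd[OF that] by simp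
      show "- f x \<le> - f p" if "x \<in> M" for x using le[OF that] neg by simp
      show "- f p > 0" by (rule neg)
      show "has_bochner_integral lborel (\<lambda>x. indicator M x * matrix_opnorm (- hessian f x)) (2 * pi * - f p)"
        using int neg by (simp add: matrix_opnorm_minus)
    qed
  qed
  then show ?thesis by blast
qed

end
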